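(* Let $G$ be a connected bridgeless graph that is not an odd wheel. Then $G$ admits an $S^1$-flow if $G$ belongs to one of the following classes: (1) the square of a connected graph with at least three vertices; (2) a locally connected graph; (3) a $2$-connected chordal graph.
   Context: All graphs are finite and loopless. An $S^1$-flow of $G$ is a pair $(D,f)$ where $D$ is an orientation of $G$ and $f:E(G)\to S^1=\{\mathbf{x}\in\mathbb{R}^2:\|\mathbf{x}\|=1\}$ satisfies, at every vertex $v$, that the sum of $f(e)$ over edges $e$ directed out of $v$ equals the sum of $f(e)$ over edges directed into $v$. The wheel $W_k$ ($k\ge 3$) is obtained from a cycle $C_k$ by adding a new vertex adjacent to every vertex of $C_k$; it is an odd wheel if $k$ is odd. The square of a graph $H$ has vertex set $V(H)$ and joins two distinct vertices when their distance in $H$ is at most $2$. A graph is locally connected if for every vertex $v$ the subgraph induced by the neighbors of $v$ is connected. *)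

theory Defs
  imports "HOL-Analysis.Analysis" "HOL-Library.Extended_Nat" "Graph_Theory.Digraph"
begin

text \<open>
  Undirected graphs may have parallel edges: edges have their own type, and \<open>gends\<close> assigns
  to every edge its set of end vertices.  Loops are excluded by \<open>card (gends G e) = 2\<close>.
\<close>

record ('v, 'e) ugraph =
  gverts :: "'v set"
  gedges :: "'e set"
  gends :: "'e \<Rightarrow> 'v set"

definition fin_loopless :: "('v, 'e) ugraph \<Rightarrow> bool" where
  "fin_loopless G \<longleftrightarrow> finite (gverts G) \<and> finite (gedges G) \<and>
     (\<forall>e\<in>gedges G. gends G e \<subseteq> gverts G \<and> card (gends G e) = 2)"

definition simple_ugraph :: "('v, 'e) ugraph \<Rightarrow> bool" where
  "simple_ugraph G \<longleftrightarrow> fin_loopless G \<and> inj_on (gends G) (gedges G)"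

definition gadj :: "('v, 'e) ugraph \<Rightarrow> ('v \<times> 'v) set" where
  "gadj G = {(u, v). \<exists>e\<in>gedges G. gends G e = {u, v}}"

definition neighbors :: "('v, 'e) ugraph \<Rightarrow> 'v \<Rightarrow> 'v set" where
  "neighbors G v = {u. (v, u) \<in> gadj G}"

definition induced :: "('v, 'e) ugraph \<Rightarrow> 'v set \<Rightarrow> ('v, 'e) ugraph" where
  "induced G S = G\<lparr>gverts := gverts G \<inter> S, gedges := {e \<in> gedges G. gends G e \<subseteq> S}\<rparr>"

definition delete_edge :: "('v, 'e) ugraph \<Rightarrow> 'e \<Rightarrow> ('v, 'e) ugraph" where
  "delete_edge G e = G\<lparr>gedges := gedges G - {e}\<rparr>"

text \<open>
  The null graph counts as connected.  This only matters for the one-vertex graph, which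
  thereby is locally connected.
\<close>

definition connected_ugraph :: "('v, 'e) ugraph \<Rightarrow> bool" where
  "connected_ugraph G \<longleftrightarrow> (\<forall>u\<in>gverts G. \<forall>v\<in>gverts G. (u, v) \<in> (gadj G)\<^sup>*)"

text \<open>A bridge is an edge that separates its two ends.\<close>

definition bridge :: "('v, 'e) ugraph \<Rightarrow> 'e \<Rightarrow> bool" where
  "bridge G e \<longleftrightarrow> e \<in> gedges G \<and>
     (\<forall>u v. gends G e = {u, v} \<longrightarrow> (u, v) \<notin> (gadj (delete_edge G e))\<^sup>*)"

definition bridgeless :: "('v, 'e) ugraph \<Rightarrow> bool" where
  "bridgeless G \<longleftrightarrow> (\<forall>e\<in>gedges G. \<not> bridge G e)"

definition two_connected :: "('v, 'e) ugraph \<Rightarrow> bool" where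
  "two_connected G \<longleftrightarrow> card (gverts G) \<ge> 3 \<and> connected_ugraph G \<and>
     (\<forall>v\<in>gverts G. connected_ugraph (induced G (gverts G - {v})))"

definition locally_connected_ugraph :: "('v, 'e) ugraph \<Rightarrow> bool" where
  "locally_connected_ugraph G \<longleftrightarrow>
     (\<forall>v\<in>gverts G. connected_ugraph (induced G (neighbors G v)))"

text \<open>Cycles of length at least 3, given by the cyclic sequence of their vertices.\<close>

definition ucycle :: "('v, 'e) ugraph \<Rightarrow> 'v list \<Rightarrow> bool" where
  "ucycle G c \<longleftrightarrow> length c \<ge> 3 \<and> distinct c \<and>
     (\<forall>i<length c. (c ! i, c ! (Suc i mod length c)) \<in> gadj G)"

text \<open>
  A chord joins two vertices that are not consecutive on the cycle; an edge parallel to an edge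
  of the cycle is not a chord.
\<close>

definition has_chord :: "('v, 'e) ugraph \<Rightarrow> 'v list \<Rightarrow> bool" where
  "has_chord G c \<longleftrightarrow> (\<exists>i<length c. \<exists>j<length c.
     i \<noteq> j \<and> j \<noteq> Suc i mod length c \<and> i \<noteq> Suc j mod length c \<and> (c ! i, c ! j) \<in> gadj G)"

definition chordal :: "('v, 'e) ugraph \<Rightarrow> bool" where
  "chordal G \<longleftrightarrow> (\<forall>c. ucycle G c \<and> length c \<ge> 4 \<longrightarrow> has_chord G c)"

definition is_cycle_graph :: "nat \<Rightarrow> ('v, 'e) ugraph \<Rightarrow> bool" where
  "is_cycle_graph k C \<longleftrightarrow> simple_ugraph C \<and>
     (\<exists>c. ucycle C c \<and> length c = k \<and> set c = gverts C \<and>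
       (\<forall>e\<in>gedges C. \<exists>i<k. gends C e = {c ! i, c ! (Suc i mod k)}))"

definition is_wheel :: "nat \<Rightarrow> ('v, 'e) ugraph \<Rightarrow> bool" where
  "is_wheel k W \<longleftrightarrow> k \<ge> 3 \<and> simple_ugraph W \<and>
     (\<exists>h\<in>gverts W. is_cycle_graph k (induced W (gverts W - {h})) \<and>
       (\<forall>v\<in>gverts W - {h}. (h, v) \<in> gadj W))"

definition is_odd_wheel :: "('v, 'e) ugraph \<Rightarrow> bool" where
  "is_odd_wheel W \<longleftrightarrow> (\<exists>k. odd k \<and> is_wheel k W)"

text \<open>The distance is \<open>\<infinity>\<close> if there is no walk, since the infimum of the empty set is \<open>\<infinity>\<close>.\<close>

definition gdist :: "('v, 'e) ugraph \<Rightarrow> 'v \<Rightarrow> 'v \<Rightarrow> enat" where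
  "gdist G u v = (INF n \<in> {n. (u, v) \<in> gadj G ^^ n}. enat n)"

definition is_square_of :: "('v, 'e) ugraph \<Rightarrow> ('v, 'h) ugraph \<Rightarrow> bool" where
  "is_square_of G H \<longleftrightarrow> simple_ugraph G \<and> gverts G = gverts H \<and>
     (\<forall>u\<in>gverts H. \<forall>v\<in>gverts H. (u, v) \<in> gadj G \<longleftrightarrow> u \<noteq> v \<and> gdist H u v \<le> 2)"

text \<open>An orientation is a digraph on the same vertices whose arcs are the edges.\<close>

definition orientation :: "('v, 'e) ugraph \<Rightarrow> ('v, 'e) pre_digraph \<Rightarrow> bool" where
  "orientation G D \<longleftrightarrow> verts D = gverts G \<and> arcs D = gedges G \<and>
     (\<forall>e\<in>gedges G. {tail D e, head D e} = gends G e)"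

definition S1_flow :: "('v, 'e) ugraph \<Rightarrow> ('v, 'e) pre_digraph \<Rightarrow> ('e \<Rightarrow> real ^ 2) \<Rightarrow> bool" where
  "S1_flow G D f \<longleftrightarrow> orientation G D \<and> (\<forall>e\<in>gedges G. f e \<in> sphere 0 1) \<and>
     (\<forall>v\<in>gverts G. (\<Sum>e\<in>out_arcs D v. f e) = (\<Sum>e\<in>in_arcs D v. f e))"

end

theory Submission
  imports Defs
begin

text \<open>
  All three classes consist of triangularly connected graphs: any two edges are joined by a
  sequence of edges in which consecutive ones are parallel or lie in a common triangle.
  A nowhere-zero \<open>\<int>\<^sub>3\<close>-flow gives an \<open>S\<^sup>1\<close>-flow, because integrality of network
  flows splits the edges into three classes with equal boundary, which can carry the three cube roots
  of unity.

  So let \<open>E\<close> be triangularly connected without \<open>\<int>\<^sub>3\<close>-flow. For each edge \<open>c\<close> there is a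
  \<open>\<int>\<^sub>3\<close>-flow vanishing only on \<open>c\<close>, and \<open>E\<close> contains an odd wheel \<open>W\<close>, obtained by closing a
  maximal 2-tree in \<open>E\<close>. A wheel realises every nonzero boundary mod 3, so every
  flow outside \<open>W\<close> has zero boundary on \<open>W\<close>. This forces
  \<open>E\<close> to be \<open>W\<close> or to split into two smaller triangularly connected parts without \<open>\<int>\<^sub>3\<close>-flow that
  share exactly one edge. By induction, each such \<open>E\<close> has, for every edge \<open>e\<close>, a flow with
  values of length 1 except for length \<open>\<surd>3\<close> on \<open>e\<close>. Two such flows on the two parts
  can be rotated against each other until their sum on the shared edge has length 1.
\<close>

section \<open>From flows modulo 3 to unit flows\<close>

text \<open>The engine is a pigeonhole: a circuit can be added with any of three multiples mod 3,
  and each edge rules out only one, so one circuit repairs two edges. A triangle or digon leaving a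
  subset has at most two edges outside it, which is why triangular connectivity yields a flow that
  fails on at most one edge. That last edge is a real obstacle: on an odd wheel the rim values would
  have to alternate in sign around an odd cycle. The length sqrt 3 measures the same defect over the
  complex numbers: potentials taken from sixth roots of unity close up around an odd cycle only with
  a jump such as \<open>1 - z^2\<close>, of that length. Two vectors of length sqrt 3 can add up to
  a unit vector, so two defects meeting on a shared edge repair each other. Residues mod 3 are
  represented by integers under divisibility, because the rounding argument needs actual integers;
  \<open>bd\<close> is defined over every commutative ring so that it serves integers, reals and
  complex numbers alike.\<close>

definition bd :: "('e \<Rightarrow> 'v) \<Rightarrow> ('e \<Rightarrow> 'v) \<Rightarrow> 'e set \<Rightarrow> ('e \<Rightarrow> 'a::comm_ring_1) \<Rightarrow> 'v \<Rightarrow> 'a" where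
  "bd s d E f v = (\<Sum>e\<in>E. f e * (of_bool (s e = v) - of_bool (d e = v)))"

lemma bd_cong: "(\<And>e. e \<in> E \<Longrightarrow> f e = g e) \<Longrightarrow> bd s d E f v = bd s d E g v"
  by (simp add: bd_def)

lemma bd_empty [simp]: "bd s d {} f v = 0"
  by (simp add: bd_def)

lemma bd_insert:
  "finite E \<Longrightarrow> e \<notin> E \<Longrightarrow>
    bd s d (insert e E) f v = f e * (of_bool (s e = v) - of_bool (d e = v)) + bd s d E f v"
  by (simp add: bd_def)

lemma bd_zero [simp]: "bd s d E (\<lambda>e. 0) v = 0"
  by (simp add: bd_def)

lemma bd_add: "bd s d E (\<lambda>e. f e + g e) v = bd s d E f v + bd s d E g v"
  by (simp add: bd_def sum.distrib distrib_right)

lemma bd_scale: "bd s d E (\<lambda>e. c * f e) v = c * bd s d E f v"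
  by (simp add: bd_def sum_distrib_left mult.assoc)

lemma bd_diff: "bd s d E (\<lambda>e. f e - g e) v = bd s d E f v - bd s d E g v"
  by (simp add: bd_def sum_subtractf left_diff_distrib)

lemma bd_Un:
  "finite A \<Longrightarrow> finite B \<Longrightarrow> A \<inter> B = {} \<Longrightarrow> bd s d (A \<union> B) f v = bd s d A f v + bd s d B f v"
  by (simp add: bd_def sum.union_disjoint)

lemma bd_split:
  "finite E \<Longrightarrow> H \<subseteq> E \<Longrightarrow> bd s d E f v = bd s d H f v + bd s d (E - H) f v"
  by (simp add: bd_def sum.subset_diff add.commute)

lemma bd_supp:
  "finite E \<Longrightarrow> H \<subseteq> E \<Longrightarrow> (\<And>e. e \<in> E - H \<Longrightarrow> f e = 0) \<Longrightarrow> bd s d E f v = bd s d H f v"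
  by (simp add: bd_def, rule sum.mono_neutral_right) auto

lemma bd_of_int: "bd s d E (\<lambda>e. of_int (f e)) v = of_int (bd s d E f v)"
  by (simp add: bd_def)

text \<open>Identification of the vertices \<open>a\<close> and \<open>b\<close>: \<open>b\<close>
  stays behind as an isolated vertex, so a contraction changes only the two end functions.\<close>

lemma bd_merge:
  assumes "s' = (\<lambda>e. if s e = b then a else s e)" "d' = (\<lambda>e. if d e = b then a else d e)" "a \<noteq> b"
  shows "bd s' d' F f v =
    (if v = b then 0 else if v = a then bd s d F f a + bd s d F f b else bd s d F f v)"
proof -
  have "bd s' d' F f v = (\<Sum>e\<in>F. if v = b then 0
      else if v = a then f e * (of_bool (s e = a) - of_bool (d e = a)) + f e * (of_bool (s e = b) - of_bool (d e = b))
      else f e * (of_bool (s e = v) - of_bool (d e = v)))"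
    unfolding bd_def using assms by (intro sum.cong) (auto simp: assms(1,2))
  then show ?thesis by (simp add: bd_def sum.distrib)
qed

text \<open>Contracting an edge keeps the hypotheses, and a circulation of the contraction extends
  to the contracted edge.\<close>

lemma nonzero_circulation:
  fixes y :: "'e \<Rightarrow> real"
  assumes "finite F" "F \<noteq> {}" "\<forall>e\<in>F. y e \<notin> \<int>" "\<forall>v. bd s d F y v \<in> \<int>"
  shows "\<exists>x::'e \<Rightarrow> real. (\<exists>e\<in>F. x e \<noteq> 0) \<and> (\<forall>v. bd s d F x v = 0)"
  using assms
proof (induction F arbitrary: s d rule: finite_induct)
  case empty
  then show ?case by simp
next
  case (insert e F)
  show ?case
  \<comment> \<open>Contraction may create loops; a loop alone carries a circulation.\<close>
  proof (cases "s e = d e")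
    case True
    have "bd s d (insert e F) (\<lambda>a. if a = e then 1 else 0::real) v = 0" for v
      using True insert.hyps by (simp add: bd_def) (rule sum.neutral, auto)
    then show ?thesis
      by (intro exI [of _ "\<lambda>a. if a = e then 1 else 0"]) auto
  next
    case False
    define s' where "s' = (\<lambda>a. if s a = d e then s e else s a)"
    define d' where "d' = (\<lambda>a. if d a = d e then s e else d a)"
    note m = bd_merge [OF s'_def d'_def False]
    have y: "bd s d (insert e F) y v = y e * (of_bool (s e = v) - of_bool (d e = v)) + bd s d F y v" for v
      using insert.hyps by (rule bd_insert)
    \<comment> \<open>As the only edge, \<open>e\<close> would pass its nonintegral value on to the
      boundary at \<open>s e\<close>.\<close>
    have "F \<noteq> {}"
    proof
      assume "F = {}"
      then have "bd s d (insert e F) y (s e) = y e" using False by (simp add: bd_def)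
      then show False using insert.prems by (metis insertI1)
    qed
    moreover have "bd s' d' F y v \<in> \<int>" for v
    proof -
      consider "v = d e" | "v = s e" | "v \<noteq> s e" "v \<noteq> d e" by blast
      then show ?thesis
      proof cases
        case 2
        have "bd s d F y (s e) + bd s d F y (d e)
            = bd s d (insert e F) y (s e) + bd s d (insert e F) y (d e)"
          unfolding y using False by simp
        then show ?thesis using insert.prems(3) 2 False by (simp add: m del: of_bool_eq)
      next
        case 3
        then have "bd s d F y v = bd s d (insert e F) y v" unfolding y by auto
        then show ?thesis using insert.prems(3) 3 by (simp add: m)
      qed (simp add: m)
    qed
    ultimately obtain x :: "'e \<Rightarrow> real" where x: "\<exists>a\<in>F. x a \<noteq> 0" "\<And>v. bd s' d' F x v = 0"
      using insert.IH [of s' d'] insert.prems by auto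
    \<comment> \<open>The value on \<open>e\<close> is forced by the boundary at \<open>s e\<close>;
      the boundary at \<open>d e\<close> then vanishes because those of \<open>x\<close> at the two
      ends add up to 0.\<close>
    define x' where "x' = x(e := - bd s d F x (s e))"
    have xF: "bd s d F x' v = bd s d F x v" for v
      using insert.hyps by (intro bd_cong) (auto simp: x'_def)
    have "bd s d (insert e F) x' v = 0" for v
    proof -
      have sum0: "bd s d F x (s e) + bd s d F x (d e) = 0"
        using x(2) [of "s e"] False by (simp add: m)
      consider "v = d e" | "v = s e" | "v \<noteq> s e" "v \<noteq> d e" by blast
      then show ?thesis
      proof cases
        case 3
        then show ?thesis using x(2) [of v] insert.hyps by (auto simp: m bd_insert xF)
      qed (use sum0 False insert.hyps in \<open>auto simp: bd_insert xF\<close>, simp_all add: x'_def)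
    qed
    moreover have "\<exists>a\<in>insert e F. x' a \<noteq> 0"
      using x(1) insert.hyps by (auto simp: x'_def)
    ultimately show ?thesis by blast
  qed
qed

text \<open>Integrality of network flows: pushing a circulation through the nonintegral edges until
  one of them reaches its floor or ceiling preserves the boundary and leaves fewer nonintegral
  values.\<close>

lemma integral_rounding:
  fixes y :: "'e \<Rightarrow> real"
  assumes "finite E" "\<forall>v. bd s d E y v \<in> \<int>"
  shows "\<exists>z::'e \<Rightarrow> int. (\<forall>e\<in>E. \<lfloor>y e\<rfloor> \<le> z e \<and> z e \<le> \<lceil>y e\<rceil>) \<and>
    (\<forall>v. of_int (bd s d E z v) = bd s d E y v)"
  using assms(2)
proof (induction "card {e\<in>E. y e \<notin> \<int>}" arbitrary: y rule: less_induct)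
  case less
  define F where "F = {e\<in>E. y e \<notin> \<int>}"
  have finF: "finite F" using assms(1) by (simp add: F_def)
  show ?case
  proof (cases "F = {}")
    case True
    have "bd s d E (\<lambda>e. of_int \<lfloor>y e\<rfloor>) v = bd s d E y v" for v
      using True by (intro bd_cong) (auto simp: F_def)
    then show ?thesis
      by (intro exI [of _ "\<lambda>e. \<lfloor>y e\<rfloor>"]) (auto simp: bd_of_int [symmetric] floor_le_ceiling)
  next
    case False
    have bdF: "\<forall>v. bd s d F y v \<in> \<int>"
    proof
      fix v
      have "bd s d E y v = bd s d F y v + bd s d (E - F) y v"
        using assms(1) by (intro bd_split) (auto simp: F_def)
      moreover have "bd s d (E - F) y v \<in> \<int>"
        unfolding bd_def by (intro Ints_sum Ints_mult) (auto simp: F_def)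
      ultimately show "bd s d F y v \<in> \<int>" using less.prems by (metis Ints_diff add_diff_cancel_right')
    qed
    have nonint: "\<forall>e\<in>F. y e \<notin> \<int>" by (simp add: F_def)
    obtain x :: "'e \<Rightarrow> real" where x: "\<exists>e\<in>F. x e \<noteq> 0" "\<forall>v. bd s d F x v = 0"
      using nonzero_circulation [OF finF False nonint bdF] by (elim exE conjE)
    define S where "S = {e\<in>F. x e \<noteq> 0}"
    \<comment> \<open>The step length at which \<open>e\<close> reaches its ceiling or floor,
      according to the sign of \<open>x e\<close>; the least of them keeps all edges in
      range.\<close>
    define t where "t = (\<lambda>e. if x e > 0 then (\<lceil>y e\<rceil> - y e) / x e else (\<lfloor>y e\<rfloor> - y e) / x e)"
    define t0 where "t0 = Min (t ` S)"
    have S: "finite S" "S \<noteq> {}" using finF x(1) by (auto simp: S_def)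
    have frac: "\<lfloor>y e\<rfloor> < y e" "y e < \<lceil>y e\<rceil>" if "e \<in> F" for e
    proof -
      have "of_int \<lfloor>y e\<rfloor> \<noteq> y e" "of_int \<lceil>y e\<rceil> \<noteq> y e"
        using that unfolding F_def by (metis (mono_tags, lifting) Ints_of_int mem_Collect_eq)+
      then show "\<lfloor>y e\<rfloor> < y e" "y e < \<lceil>y e\<rceil>"
        using of_int_floor_le [of "y e"] le_of_int_ceiling [of "y e"] by linarith+
    qed
    have tpos: "t e > 0" if "e \<in> S" for e
      using frac [of e] that by (auto simp: t_def S_def divide_neg_neg)
    have t0: "t0 > 0" "\<And>e. e \<in> S \<Longrightarrow> t0 \<le> t e" "t0 \<in> t ` S"
      using S tpos by (auto simp: t0_def)
    define y' where "y' = (\<lambda>e. if e \<in> F then y e + t0 * x e else y e)"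
    have range: "\<lfloor>y e\<rfloor> \<le> y' e \<and> y' e \<le> \<lceil>y e\<rceil>" if "e \<in> E" for e
    proof (cases "e \<in> S")
      case True
      then have F: "e \<in> F" and "x e \<noteq> 0" by (auto simp: S_def)
      then consider "x e > 0" | "x e < 0" by linarith
      then show ?thesis
      proof cases
        case 1
        then have "t0 * x e \<le> \<lceil>y e\<rceil> - y e"
          using t0(2) [OF True] by (simp add: t_def pos_le_divide_eq)
        moreover have "t0 * x e \<ge> 0" using 1 t0(1) by simp
        ultimately show ?thesis using F frac [of e] by (simp add: y'_def)
      next
        case 2
        then have "t0 * x e \<ge> \<lfloor>y e\<rfloor> - y e"
          using t0(2) [OF True] by (simp add: t_def neg_le_divide_eq)
        moreover have "t0 * x e \<le> 0" using 2 t0(1) by (simp add: mult_le_0_iff)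
        ultimately show ?thesis using F frac [of e] by (simp add: y'_def)
      qed
    next
      case False
      then have "y' e = y e" by (auto simp: y'_def S_def)
      then show ?thesis by simp
    qed
    obtain e0 where e0: "e0 \<in> S" "t0 = t e0" using t0(3) by auto
    then have "y' e0 \<in> \<int>" by (auto simp: y'_def t_def S_def)
    moreover have "{e\<in>E. y' e \<notin> \<int>} \<subseteq> F" by (auto simp: y'_def F_def)
    ultimately have "{e\<in>E. y' e \<notin> \<int>} \<subset> F" using e0 by (auto simp: S_def)
    then have "card {e\<in>E. y' e \<notin> \<int>} < card {e\<in>E. y e \<notin> \<int>}"
      using finF psubset_card_mono unfolding F_def by blast
    moreover have bd': "bd s d E y' v = bd s d E y v" for v
    proof -
      have "bd s d E y' v = bd s d E (\<lambda>e. y e + t0 * (if e \<in> F then x e else 0)) v"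
        by (intro bd_cong) (auto simp: y'_def)
      also have "\<dots> = bd s d E y v + t0 * bd s d E (\<lambda>e. if e \<in> F then x e else 0) v"
        by (simp only: bd_add bd_scale)
      also have "bd s d E (\<lambda>e. if e \<in> F then x e else 0) v = bd s d F (\<lambda>e. if e \<in> F then x e else 0) v"
        using assms(1) by (intro bd_supp) (auto simp: F_def)
      also have "\<dots> = bd s d F x v" by (intro bd_cong) auto
      finally show ?thesis using x(2) by simp
    qed
    ultimately obtain z where z: "\<forall>e\<in>E. \<lfloor>y' e\<rfloor> \<le> z e \<and> z e \<le> \<lceil>y' e\<rceil>"
      "\<forall>v. of_int (bd s d E z v) = bd s d E y v"
      using less.hyps [of y'] less.prems by auto
    \<comment> \<open>The interval given by floor and ceiling of \<open>y' e\<close> lies inside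
      that of \<open>y e\<close>, so the bounds survive the recursion.\<close>
    have "\<lfloor>y e\<rfloor> \<le> z e \<and> z e \<le> \<lceil>y e\<rceil>" if "e \<in> E" for e
    proof -
      have "\<lfloor>y e\<rfloor> \<le> \<lfloor>y' e\<rfloor>" "\<lceil>y' e\<rceil> \<le> \<lceil>y e\<rceil>"
        using range [OF that] by (auto simp: le_floor_iff ceiling_le_iff)
      then show ?thesis using z(1) that by force
    qed
    then show ?thesis using z(2) by blast
  qed
qed

section \<open>Flows mod 3 and the cube roots of unity\<close>

definition z3flow :: "('e \<Rightarrow> 'v) \<Rightarrow> ('e \<Rightarrow> 'v) \<Rightarrow> 'e set \<Rightarrow> bool" where
  "z3flow s d E \<longleftrightarrow> (\<exists>f::'e \<Rightarrow> int. (\<forall>e\<in>E. \<not> 3 dvd f e) \<and> (\<forall>v. 3 dvd bd s d E f v))"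

definition unitflow :: "('e \<Rightarrow> 'v) \<Rightarrow> ('e \<Rightarrow> 'v) \<Rightarrow> 'e set \<Rightarrow> bool" where
  "unitflow s d E \<longleftrightarrow> (\<exists>f::'e \<Rightarrow> complex. (\<forall>e\<in>E. cmod (f e) = 1) \<and> (\<forall>v. bd s d E f v = 0))"

text \<open>On each edge \<open>g / n\<close> lies between 0 and \<open>g e\<close>, so rounding
  yields one of these two; the edges with a nonzero rounded value form \<open>A\<close>.\<close>

lemma bd_class:
  fixes g :: "'e \<Rightarrow> int"
  assumes "finite E" and g: "\<forall>e\<in>E. g e \<in> {1, -1}" and D: "\<forall>v. bd s d E g v = n * D v" and "n \<ge> 1"
  shows "\<exists>A\<subseteq>E. \<forall>v. bd s d A g v = D v"
proof -
  have "bd s d E (\<lambda>e. (1 / of_int n) * of_int (g e) :: real) v = of_int (D v)" for v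
    using D \<open>n \<ge> 1\<close> unfolding bd_scale bd_of_int by simp
  then obtain z where z: "\<forall>e\<in>E. \<lfloor>(1 / of_int n) * of_int (g e) :: real\<rfloor> \<le> z e \<and> z e \<le> \<lceil>(1 / of_int n) * of_int (g e) :: real\<rceil>"
     "\<And>v. bd s d E z v = D v"
    using integral_rounding [OF \<open>finite E\<close>, of s d "\<lambda>e. (1 / of_int n) * of_int (g e) :: real"]
    by (metis Ints_of_int of_int_eq_iff)
  have zg: "z e = 0 \<or> z e = g e" if "e \<in> E" for e
  proof -
    have n: "0 \<le> 1 / real_of_int n" "1 / real_of_int n \<le> 1" using \<open>n \<ge> 1\<close> by auto
    consider "g e = 1" | "g e = -1" using g \<open>e \<in> E\<close> by auto
    then show ?thesis
    proof cases
      case 1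
      have "0 \<le> \<lfloor>1 / real_of_int n\<rfloor>" "\<lceil>1 / real_of_int n\<rceil> \<le> 1"
        using n unfolding ceiling_le_iff le_floor_iff by auto
      moreover have "\<lfloor>1 / real_of_int n\<rfloor> \<le> z e \<and> z e \<le> \<lceil>1 / real_of_int n\<rceil>"
        using z(1) that 1 by fastforce
      ultimately have "0 \<le> z e" "z e \<le> 1" by linarith+
      then show ?thesis using 1 by auto
    next
      case 2
      have "-1 \<le> \<lfloor>- (1 / real_of_int n)\<rfloor>" "\<lceil>- (1 / real_of_int n)\<rceil> \<le> 0"
        using n unfolding ceiling_le_iff le_floor_iff by auto
      moreover have "\<lfloor>- (1 / real_of_int n)\<rfloor> \<le> z e \<and> z e \<le> \<lceil>- (1 / real_of_int n)\<rceil>"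
        using z(1) that 2 by fastforce
      ultimately have "-1 \<le> z e" "z e \<le> 0" by linarith+
      then show ?thesis using 2 by auto
    qed
  qed
  have "bd s d {e\<in>E. z e \<noteq> 0} g v = D v" for v
  proof -
    have "bd s d {e\<in>E. z e \<noteq> 0} g v = bd s d {e\<in>E. z e \<noteq> 0} z v"
      using zg by (intro bd_cong) fastforce
    also have "\<dots> = bd s d E z v"
      using \<open>finite E\<close> by (intro bd_supp [symmetric]) auto
    finally show ?thesis using z(2) by simp
  qed
  then show ?thesis by (intro exI [of _ "{e\<in>E. z e \<noteq> 0}"]) auto
qed

text \<open>The edges are split into three classes with the same boundary, which carry the three
  cube roots of unity.\<close>

lemma unitflow_if_z3flow:
  assumes "finite E" "z3flow s d E"
  shows "unitflow s d E"
proof -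
  obtain f :: "'a \<Rightarrow> int" where f: "\<forall>e\<in>E. \<not> 3 dvd f e" "\<forall>v. 3 dvd bd s d E f v"
    using assms(2) by (auto simp: z3flow_def)
  \<comment> \<open>The representative of \<open>f\<close> mod 3 with values 1 and -1 on
    \<open>E\<close>.\<close>
  define g where "g = (\<lambda>e. if f e mod 3 = 1 then 1 else -1 :: int)"
  have g: "g e \<in> {1, -1}" "3 dvd g e - f e" if "e \<in> E" for e
  proof -
    have "\<not> 3 dvd f e" using f that by blast
    then show "g e \<in> {1, -1}" "3 dvd g e - f e" by (auto simp: g_def, presburger+)
  qed
  have "3 dvd bd s d E g v" for v
  proof -
    have "3 dvd bd s d E (\<lambda>e. g e - f e) v"
      unfolding bd_def using g(2) by (intro dvd_sum) auto
    then show ?thesis using f(2) unfolding bd_diff by (metis diff_add_cancel dvd_add)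
  qed
  then have "\<exists>D. \<forall>v. bd s d E g v = 3 * D v" by (intro choice) (auto simp: dvd_def)
  then obtain D where D: "\<forall>v. bd s d E g v = 3 * D v" by blast
  obtain A where A: "A \<subseteq> E" "\<forall>v. bd s d A g v = D v"
    using bd_class [OF assms(1) _ D] g(1) by auto
  have finA: "finite A" using A(1) assms(1) finite_subset by blast
  \<comment> \<open>A third of the boundary is gone; halving the rest gives \<open>B\<close> and
    leaves \<open>D\<close> for \<open>C\<close>.\<close>
  have "bd s d (E - A) g v = 2 * D v" for v
    using bd_split [OF assms(1) A(1), of s d g v] A(2) D by simp
  then obtain B where B: "B \<subseteq> E - A" "\<forall>v. bd s d B g v = D v"
    using bd_class [of "E - A" g s d 2 D] g(1) assms(1) by auto
  define C where "C = E - A - B"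
  have C: "bd s d C g v = D v" for v
    using bd_split [of "E - A" B s d g v] \<open>bd s d (E - A) g v = 2 * D v\<close> B assms(1)
    by (simp add: C_def)
  define w :: complex where "w = cis (2 * pi / 3)"
  have "w ^ 3 = cis (real 3 * (2 * pi / 3))" unfolding w_def by (rule Complex.DeMoivre)
  then have "w ^ 3 = 1" by simp
  moreover have "w \<noteq> 1"
    by (simp add: w_def complex_eq_iff cos_120)
  ultimately have w: "1 + w + w ^ 2 = 0"
  proof -
    assume "w ^ 3 = 1" "w \<noteq> 1"
    have "(w - 1) * (1 + w + w ^ 2) = w ^ 3 - 1" by (simp add: algebra_simps power3_eq_cube power2_eq_square)
    then show ?thesis using \<open>w ^ 3 = 1\<close> \<open>w \<noteq> 1\<close> by simp
  qed
  define F where "F = (\<lambda>e. (if e \<in> A then 1 else if e \<in> B then w else w ^ 2) * of_int (g e))"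
  have "bd s d E F v = 0" for v
  proof -
    have "bd s d E F v = bd s d A F v + (bd s d B F v + bd s d C F v)"
      using bd_split [OF assms(1) A(1), of s d F v] bd_split [of "E - A" B s d F v] B(1) assms(1)
      by (simp add: C_def)
    also have "bd s d A F v = bd s d A (\<lambda>e. 1 * of_int (g e)) v"
      by (intro bd_cong) (auto simp: F_def)
    also have "bd s d B F v = bd s d B (\<lambda>e. w * of_int (g e)) v"
      using B by (intro bd_cong) (auto simp: F_def)
    also have "bd s d C F v = bd s d C (\<lambda>e. w ^ 2 * of_int (g e)) v"
      by (intro bd_cong) (auto simp: F_def C_def)
    finally have "bd s d E F v = (1 + w + w ^ 2) * of_int (D v)"
      using A B C by (simp only: bd_scale bd_of_int) (simp add: algebra_simps)
    then show ?thesis using w by simp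
  qed
  moreover have "cmod (F e) = 1" if "e \<in> E" for e
    using g(1) [OF that] by (auto simp: F_def w_def norm_mult norm_power)
  ultimately show ?thesis by (auto simp: unitflow_def)
qed

section \<open>Triangular connectivity\<close>

text \<open>As \<open>p\<close> and \<open>q\<close> are units mod 3, each condition forbids one of
  the three residues of \<open>x\<close>.\<close>

lemma avoid_two_residues:
  fixes a b p q :: int
  assumes "p \<in> {1, -1}" "q \<in> {1, -1}"
  shows "\<exists>x. \<not> 3 dvd a + x * p \<and> \<not> 3 dvd b + x * q"
proof -
  have "\<exists>x. \<not> 3 dvd a + x \<and> \<not> 3 dvd b + x"
    "\<exists>x. \<not> 3 dvd a + x \<and> \<not> 3 dvd b - x"
    "\<exists>x. \<not> 3 dvd a - x \<and> \<not> 3 dvd b + x"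
    "\<exists>x. \<not> 3 dvd a - x \<and> \<not> 3 dvd b - x"
    by presburger+
  then show ?thesis using assms by auto
qed

text \<open>Every element of the edge type has two ends, also outside the graph at hand; facts about
  \<open>ends\<close> and \<open>triangle\<close> thus need no membership premises.\<close>

locale loopless =
  fixes s d :: "'e \<Rightarrow> 'v"
  assumes src_neq_dst: "s e \<noteq> d e"
begin

definition ends :: "'e \<Rightarrow> 'v set" where
  "ends e = {s e, d e}"

definition triangle :: "'e \<Rightarrow> 'e \<Rightarrow> 'e \<Rightarrow> bool" where
  "triangle e f g \<longleftrightarrow> (\<exists>x y z. x \<noteq> y \<and> y \<noteq> z \<and> x \<noteq> z \<and>
     ends e = {x, y} \<and> ends f = {y, z} \<and> ends g = {x, z})"

text \<open>The sign of \<open>e\<close> when traversed starting at \<open>x\<close>; paths and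
  cycles can then be written down independently of the orientation.\<close>

definition dir :: "'e \<Rightarrow> 'v \<Rightarrow> 'a::comm_ring_1" where
  "dir e x = (if s e = x then 1 else -1)"

text \<open>Vanishing off \<open>T\<close> allows a multiple of \<kappa> to be added to a function
  on any superset of \<open>T\<close> without changing its boundary.\<close>

definition circuit :: "'e set \<Rightarrow> ('e \<Rightarrow> int) \<Rightarrow> bool" where
  "circuit T \<kappa> \<longleftrightarrow> finite T \<and> (\<forall>e\<in>T. \<kappa> e \<in> {1, -1}) \<and> (\<forall>e. e \<notin> T \<longrightarrow> \<kappa> e = 0) \<and>
     (\<forall>v. bd s d T \<kappa> v = 0)"

definition trel :: "'e set \<Rightarrow> ('e \<times> 'e) set" where
  "trel E = {(e, f). e \<in> E \<and> f \<in> E \<and> (ends e = ends f \<or> (\<exists>g\<in>E. triangle e f g))}"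

definition tricon :: "'e set \<Rightarrow> bool" where
  "tricon E \<longleftrightarrow> (\<forall>e\<in>E. \<forall>f\<in>E. (e, f) \<in> (trel E)\<^sup>*)"

lemma z3flowI:
  fixes f :: "'e \<Rightarrow> int"
  shows "(\<And>e. e \<in> E \<Longrightarrow> \<not> 3 dvd f e) \<Longrightarrow> (\<And>v. 3 dvd bd s d E f v) \<Longrightarrow> z3flow s d E"
  unfolding z3flow_def by blast

lemma dir_cases: "(dir e x :: int) \<in> {1, -1}"
  by (simp add: dir_def)

lemma ends_neq: "ends e = {x, y} \<Longrightarrow> x \<noteq> y"
  using src_neq_dst [of e] by (auto simp: ends_def doubleton_eq_iff)

lemma dir_bd:
  "ends e = {x, y} \<Longrightarrow>
    dir e x * (of_bool (s e = v) - of_bool (d e = v)) = (of_bool (x = v) - of_bool (y = v) :: 'a::comm_ring_1)"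
  using src_neq_dst [of e] by (auto simp: ends_def doubleton_eq_iff dir_def)

lemma triangleI:
  "x \<noteq> y \<Longrightarrow> y \<noteq> z \<Longrightarrow> x \<noteq> z \<Longrightarrow> ends e = {x, y} \<Longrightarrow> ends f = {y, z} \<Longrightarrow> ends g = {x, z} \<Longrightarrow> triangle e f g"
  unfolding triangle_def by blast

lemma triangle_swap12:
  assumes "triangle e f g" shows "triangle f e g"
proof -
  obtain x y z where "x \<noteq> y" "y \<noteq> z" "x \<noteq> z" "ends e = {x, y}" "ends f = {y, z}" "ends g = {x, z}"
    using assms by (auto simp: triangle_def)
  then show ?thesis by (intro triangleI [of z y x]) auto
qed

lemma triangle_swap23:
  assumes "triangle e f g" shows "triangle e g f"
proof -
  obtain x y z where "x \<noteq> y" "y \<noteq> z" "x \<noteq> z" "ends e = {x, y}" "ends f = {y, z}" "ends g = {x, z}"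
    using assms by (auto simp: triangle_def)
  then show ?thesis by (intro triangleI [of y x z]) auto
qed

lemma triangle_perms:
  assumes "triangle e f g"
  shows "triangle f e g" "triangle e g f" "triangle g e f" "triangle f g e" "triangle g f e"
  using assms by (blast intro: triangle_swap12 triangle_swap23)+

lemma triangle_distinct: "triangle e f g \<Longrightarrow> e \<noteq> f \<and> f \<noteq> g \<and> e \<noteq> g"
  by (auto simp: triangle_def doubleton_eq_iff)

lemma triangle_circuit:
  assumes "triangle e f g"
  shows "\<exists>\<kappa>. circuit {e, f, g} \<kappa>"
proof -
  obtain x y z where xyz: "ends e = {x, y}" "ends f = {y, z}" "ends g = {z, x}"
    using assms by (auto simp: triangle_def insert_commute)
  note dist = triangle_distinct [OF assms]
  define \<kappa> :: "'e \<Rightarrow> int" where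
    "\<kappa> = (\<lambda>a. if a = e then dir e x else if a = f then dir f y else if a = g then dir g z else 0)"
  have "bd s d {e, f, g} \<kappa> v = 0" for v
  proof -
    have "bd s d {e, f, g} \<kappa> v = dir e x * (of_bool (s e = v) - of_bool (d e = v))
       + (dir f y * (of_bool (s f = v) - of_bool (d f = v))
       + dir g z * (of_bool (s g = v) - of_bool (d g = v)))"
      using dist by (auto simp: bd_def \<kappa>_def)
    then show ?thesis by (simp add: dir_bd [OF xyz(1)] dir_bd [OF xyz(2)] dir_bd [OF xyz(3)])
  qed
  then show ?thesis
    using dir_cases by (intro exI [of _ \<kappa>]) (auto simp: circuit_def \<kappa>_def)
qed

lemma digon_circuit:
  assumes "ends e = ends f" "e \<noteq> f"
  shows "\<exists>\<kappa>. circuit {e, f} \<kappa>"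
proof -
  have xy: "ends e = {s e, d e}" "ends f = {d e, s e}"
    using assms(1) by (auto simp: ends_def)
  define \<kappa> :: "'e \<Rightarrow> int" where
    "\<kappa> = (\<lambda>a. if a = e then dir e (s e) else if a = f then dir f (d e) else 0)"
  have "bd s d {e, f} \<kappa> v = 0" for v
  proof -
    have "bd s d {e, f} \<kappa> v = dir e (s e) * (of_bool (s e = v) - of_bool (d e = v))
       + dir f (d e) * (of_bool (s f = v) - of_bool (d f = v))"
      using assms(2) by (auto simp: bd_def \<kappa>_def)
    then show ?thesis unfolding dir_bd [OF xy(1)] dir_bd [OF xy(2)] by simp
  qed
  then show ?thesis
    using dir_cases by (intro exI [of _ \<kappa>]) (auto simp: circuit_def \<kappa>_def)
qed

lemma circuit_bd: "circuit T \<kappa> \<Longrightarrow> T \<subseteq> E \<Longrightarrow> finite E \<Longrightarrow> bd s d E \<kappa> v = 0"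
  by (subst bd_supp [of E T]) (auto simp: circuit_def)

lemma trel_sym: "(e, f) \<in> trel E \<Longrightarrow> (f, e) \<in> trel E"
  by (auto simp: trel_def dest: triangle_perms)

lemma trel_rtrancl_sym: "(e, f) \<in> (trel E)\<^sup>* \<Longrightarrow> (f, e) \<in> (trel E)\<^sup>*"
  using sym_rtrancl [of "trel E"] trel_sym by (meson symD symI)

lemma trel_mono: "E \<subseteq> F \<Longrightarrow> trel E \<subseteq> trel F"
  by (auto simp: trel_def)

lemma triangle_trel: "triangle e f g \<Longrightarrow> {e, f, g} \<subseteq> E \<Longrightarrow> (e, f) \<in> trel E"
  by (auto simp: trel_def)

lemma triconI:
  assumes "\<And>e. e \<in> E \<Longrightarrow> (e, c) \<in> (trel E)\<^sup>*"
  shows "tricon E"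
  unfolding tricon_def using assms trel_rtrancl_sym by (meson rtrancl_trans)

lemma tricon_cross:
  assumes "tricon E" "H \<subseteq> E" "c \<in> H" "H \<noteq> E"
  obtains e f where "(e, f) \<in> trel E" "e \<in> H" "f \<in> E - H"
proof -
  obtain a where a: "a \<in> E - H" using assms by blast
  have "(c, a) \<in> (trel E)\<^sup>*" using assms a by (auto simp: tricon_def)
  then have "c \<in> H \<Longrightarrow> a \<notin> H \<Longrightarrow> \<exists>e f. (e, f) \<in> trel E \<and> e \<in> H \<and> f \<notin> H"
    by (induction rule: rtrancl_induct) blast+
  then show ?thesis using assms a that by (auto simp: trel_def)
qed

text \<open>Arbitrary boundaries are matched, not only zero: fixing the values on edges outside
  \<open>H\<close> leaves \<open>H\<close> with whatever boundary remains.\<close>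

definition flexible :: "'e \<Rightarrow> 'e set \<Rightarrow> bool" where
  "flexible c H \<longleftrightarrow> (\<forall>\<phi>::'e \<Rightarrow> int. \<exists>\<psi>::'e \<Rightarrow> int. (\<forall>e\<in>H - {c}. \<not> 3 dvd \<psi> e) \<and>
     (\<forall>v. 3 dvd bd s d H \<psi> v - bd s d H \<phi> v))"

text \<open>Values on the new edges are corrected first, by adding a multiple of the circuit; the
  damage done on \<open>H\<close> is then repaired inside \<open>H\<close>.\<close>

lemma flexible_extend:
  assumes "finite H" "flexible c H" "circuit T \<kappa>" "f \<in> T - H" "g \<in> T - H" "T \<subseteq> H \<union> {f, g}"
  shows "flexible c (H \<union> {f, g})"
  unfolding flexible_def
proof
  fix \<phi> :: "'e \<Rightarrow> int"
  have "\<kappa> f \<in> {1, -1}" "\<kappa> g \<in> {1, -1}" using assms by (auto simp: circuit_def)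
  then obtain x where x: "\<not> 3 dvd \<phi> f + x * \<kappa> f" "\<not> 3 dvd \<phi> g + x * \<kappa> g"
    using avoid_two_residues by blast
  define \<phi>' where "\<phi>' = (\<lambda>e. \<phi> e + x * \<kappa> e)"
  obtain \<psi> :: "'e \<Rightarrow> int" where \<psi>: "\<forall>e\<in>H - {c}. \<not> 3 dvd \<psi> e" "\<forall>v. 3 dvd bd s d H \<psi> v - bd s d H \<phi>' v"
    using assms(2) unfolding flexible_def by blast
  define \<psi>' where "\<psi>' = (\<lambda>e. if e \<in> H then \<psi> e else \<phi>' e)"
  have fin: "finite (H \<union> {f, g})" using assms(1) by simp
  have "bd s d (H \<union> {f, g}) \<psi>' v - bd s d (H \<union> {f, g}) \<phi> v = bd s d H \<psi> v - bd s d H \<phi>' v" for v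
  proof -
    let ?N = "H \<union> {f, g} - H"
    have "bd s d (H \<union> {f, g}) \<phi> v = bd s d (H \<union> {f, g}) \<phi>' v"
      unfolding \<phi>'_def bd_add bd_scale circuit_bd [OF assms(3,6) fin] by simp
    also have "\<dots> = bd s d H \<phi>' v + bd s d ?N \<phi>' v"
      by (rule bd_split [OF fin]) auto
    finally have "bd s d (H \<union> {f, g}) \<phi> v = bd s d H \<phi>' v + bd s d ?N \<phi>' v" .
    moreover have "bd s d (H \<union> {f, g}) \<psi>' v = bd s d H \<psi>' v + bd s d ?N \<psi>' v"
      by (rule bd_split [OF fin]) auto
    moreover have "bd s d H \<psi>' v = bd s d H \<psi> v" "bd s d ?N \<psi>' v = bd s d ?N \<phi>' v"
      by (auto intro!: bd_cong simp: \<psi>'_def)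
    ultimately show ?thesis by simp
  qed
  moreover have "\<not> 3 dvd \<psi>' e" if "e \<in> H \<union> {f, g} - {c}" for e
    using that \<psi>(1) x assms(4,5) by (auto simp: \<psi>'_def \<phi>'_def)
  ultimately show "\<exists>\<psi>. (\<forall>e\<in>H \<union> {f, g} - {c}. \<not> 3 dvd \<psi> e) \<and>
      (\<forall>v. 3 dvd bd s d (H \<union> {f, g}) \<psi> v - bd s d (H \<union> {f, g}) \<phi> v)"
    using \<psi>(2) by (intro exI [of _ \<psi>']) simp
qed

text \<open>A maximal flexible subset containing \<open>c\<close> is all of \<open>E\<close>, since
  a digon or triangle across its border has one or two edges outside and
  \<open>flexible_extend\<close> absorbs them.\<close>

lemma tricon_flexible:
  assumes "finite E" "tricon E" "c \<in> E"
  shows "flexible c E"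
proof -
  let ?F = "{H. H \<subseteq> E \<and> c \<in> H \<and> flexible c H}"
  have "\<exists>\<psi>. \<forall>v. 3 dvd bd s d {c} \<psi> v - bd s d {c} \<phi> v" for \<phi> :: "'e \<Rightarrow> int"
    by (intro exI [of _ \<phi>]) simp
  then have "{c} \<in> ?F" using assms(3) by (simp add: flexible_def)
  moreover have "finite ?F" using assms(1) by simp
  ultimately obtain H where H: "H \<in> ?F" "\<And>H'. H' \<in> ?F \<Longrightarrow> H \<subseteq> H' \<Longrightarrow> H = H'"
    by (metis (no_types, lifting) empty_iff finite_has_maximal)
  have "H = E"
  proof (rule ccontr)
    assume "H \<noteq> E"
    then obtain e f where ef: "(e, f) \<in> trel E" "e \<in> H" "f \<in> E - H"
      using tricon_cross assms(2) H(1) by blast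
    have "finite H" "flexible c H" using H(1) assms(1) finite_subset by auto
    note extend = flexible_extend [OF this]
    have "\<exists>g\<in>E. flexible c (H \<union> {f, g})"
    proof (cases "ends e = ends f")
      case True
      \<comment> \<open>Using \<open>f\<close> in both roles expresses that there is a single new
        edge.\<close>
      then obtain \<kappa> where "circuit {e, f} \<kappa>" using digon_circuit ef by blast
      then show ?thesis using extend [of "{e, f}" \<kappa> f f] ef by (intro bexI [of _ f]) auto
    next
      case False
      then obtain g where g: "g \<in> E" "triangle e f g" using ef by (auto simp: trel_def)
      then obtain \<kappa> where \<kappa>: "circuit {e, f, g} \<kappa>" using triangle_circuit by blast
      show ?thesis
      proof (cases "g \<in> H")
        case True
        then show ?thesis using extend [OF \<kappa>, of f f] ef by (intro bexI [of _ f]) auto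
      next
        case False
        then show ?thesis using extend [OF \<kappa>, of f g] ef g by auto
      qed
    qed
    then obtain g where "g \<in> E" "flexible c (H \<union> {f, g})" by blast
    then have "H \<union> {f, g} \<in> ?F" using H(1) ef by auto
    then show False using H(2) [of "H \<union> {f, g}"] ef by blast
  qed
  then show ?thesis using H by simp
qed

lemma tricon_near_flow:
  assumes "finite E" "tricon E" "c \<in> E"
  shows "\<exists>\<phi>::'e \<Rightarrow> int. (\<forall>e\<in>E - {c}. \<not> 3 dvd \<phi> e) \<and> (\<forall>v. 3 dvd bd s d E \<phi> v)"
  using tricon_flexible [OF assms] unfolding flexible_def
  by (drule_tac x = "\<lambda>e. 0" in spec) simp

text \<open>The flow that may fail on \<open>c\<close> must vanish there mod 3, so \<open>c\<close>
  contributes nothing to its boundary.\<close>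

lemma z3flow_delete:
  assumes "finite E" "tricon E" "c \<in> E" "\<not> z3flow s d E"
  shows "z3flow s d (E - {c})"
proof -
  obtain \<phi> :: "'e \<Rightarrow> int" where \<phi>: "\<forall>e\<in>E - {c}. \<not> 3 dvd \<phi> e" "\<forall>v. 3 dvd bd s d E \<phi> v"
    using tricon_near_flow [OF assms(1-3)] by blast
  then have "3 dvd \<phi> c" using assms(4) unfolding z3flow_def by (metis DiffI singletonD)
  then have "3 dvd bd s d {c} \<phi> v" for v by (simp add: bd_def)
  moreover have "bd s d E \<phi> v = bd s d {c} \<phi> v + bd s d (E - {c}) \<phi> v" for v
    using assms by (intro bd_split) auto
  ultimately have "3 dvd bd s d (E - {c}) \<phi> v" for v
    using \<phi>(2) by (metis dvd_add_right_iff)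
  then show ?thesis using \<phi>(1) by (auto simp: z3flow_def)
qed

lemma z3flow_replace:
  fixes \<phi> \<psi> :: "'e \<Rightarrow> int"
  assumes "finite E" "H \<subseteq> E" "\<forall>e\<in>E - H. \<not> 3 dvd \<phi> e" "\<forall>v. 3 dvd bd s d E \<phi> v"
    and "\<forall>e\<in>H. \<not> 3 dvd \<psi> e" "\<forall>v. 3 dvd bd s d H \<psi> v - bd s d H \<phi> v"
  shows "z3flow s d E"
proof -
  define \<theta> where "\<theta> = (\<lambda>e. if e \<in> H then \<psi> e else \<phi> e)"
  have "3 dvd bd s d E \<theta> v" for v
  proof -
    have "bd s d E \<theta> v = bd s d H \<theta> v + bd s d (E - H) \<theta> v"
      "bd s d E \<phi> v = bd s d H \<phi> v + bd s d (E - H) \<phi> v"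
      by (rule bd_split [OF assms(1,2)])+
    moreover have "bd s d H \<theta> v = bd s d H \<psi> v" "bd s d (E - H) \<theta> v = bd s d (E - H) \<phi> v"
      by (auto intro!: bd_cong simp: \<theta>_def)
    ultimately have "bd s d E \<theta> v = bd s d E \<phi> v + (bd s d H \<psi> v - bd s d H \<phi> v)" by simp
    then show ?thesis using assms(4,6) by simp
  qed
  then show ?thesis
    unfolding z3flow_def using assms(3,5) by (intro exI [of _ \<theta>]) (auto simp: \<theta>_def)
qed

lemma z3flow_Un:
  assumes "finite A" "finite B" "A \<inter> B = {}" "z3flow s d A" "z3flow s d B"
  shows "z3flow s d (A \<union> B)"
proof -
  obtain f g :: "'e \<Rightarrow> int" where f: "\<forall>e\<in>A. \<not> 3 dvd f e" "\<forall>v. 3 dvd bd s d A f v"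
    and g: "\<forall>e\<in>B. \<not> 3 dvd g e" "\<forall>v. 3 dvd bd s d B g v"
    using assms(4,5) by (auto simp: z3flow_def)
  define h where "h = (\<lambda>e. if e \<in> A then f e else g e)"
  have "bd s d A h v = bd s d A f v" "bd s d B h v = bd s d B g v" for v
    using assms(3) by (auto intro!: bd_cong simp: h_def)
  then have "3 dvd bd s d (A \<union> B) h v" for v
    using f g assms by (simp add: bd_Un)
  moreover have "\<forall>e\<in>A \<union> B. \<not> 3 dvd h e" using f(1) g(1) by (auto simp: h_def)
  ultimately show ?thesis unfolding z3flow_def by blast
qed

text \<open>A flow that fails only on \<open>e\<close> could be repaired by a multiple of the digon,
  which has just two residues to avoid.\<close>

lemma no_parallel_edges:
  assumes "finite E" "tricon E" "\<not> z3flow s d E" "e \<in> E" "f \<in> E" "ends e = ends f"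
  shows "e = f"
proof (rule ccontr)
  assume "e \<noteq> f"
  then obtain \<kappa> where \<kappa>: "circuit {e, f} \<kappa>" using digon_circuit assms by blast
  obtain \<phi> :: "'e \<Rightarrow> int" where \<phi>: "\<forall>a\<in>E - {e}. \<not> 3 dvd \<phi> a" "\<forall>v. 3 dvd bd s d E \<phi> v"
    using tricon_near_flow assms by blast
  obtain x where x: "\<not> 3 dvd \<phi> e + x * \<kappa> e" "\<not> 3 dvd \<phi> f + x * \<kappa> f"
    using avoid_two_residues \<kappa> by (metis circuit_def insert_iff)
  define \<psi> where "\<psi> = (\<lambda>a. \<phi> a + x * \<kappa> a)"
  have "bd s d E \<psi> v = bd s d E \<phi> v" for v
    unfolding \<psi>_def bd_add bd_scale using circuit_bd [OF \<kappa>] assms by simp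
  moreover have "\<not> 3 dvd \<psi> a" if "a \<in> E" for a
    using that x \<phi>(1) \<kappa> by (cases "a = e \<or> a = f") (auto simp: \<psi>_def circuit_def)
  ultimately have "z3flow s d E" using \<phi>(2) by (intro z3flowI [of _ \<psi>]) auto
  then show False using assms(3) by blast
qed

text \<open>A flow failing at most on \<open>e\<close> is extended by 0. The multiple of the
  triangle is chosen for \<open>e\<close> and \<open>f\<close> only: on \<open>f\<close> and
  \<open>g\<close> the new values agree up to sign, so \<open>g\<close> is served as well.\<close>

lemma z3flow_ear:
  assumes "finite K" "tricon K" "e \<in> K" "f \<notin> K" "g \<notin> K" "triangle e f g"
  shows "z3flow s d (K \<union> {f, g})"
proof -
  obtain \<kappa> where \<kappa>: "circuit {e, f, g} \<kappa>" using triangle_circuit assms by blast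
  obtain \<phi> :: "'e \<Rightarrow> int" where \<phi>: "\<forall>a\<in>K - {e}. \<not> 3 dvd \<phi> a" "\<forall>v. 3 dvd bd s d K \<phi> v"
    using tricon_near_flow assms by blast
  obtain x where x: "\<not> 3 dvd \<phi> e + x * \<kappa> e" "\<not> 3 dvd 0 + x * \<kappa> f"
    using avoid_two_residues \<kappa> by (metis circuit_def insert_iff)
  have pm: "\<kappa> f \<in> {1, -1}" "\<kappa> g \<in> {1, -1}" using \<kappa> by (auto simp: circuit_def)
  define \<phi>' where "\<phi>' = (\<lambda>a. if a \<in> K then \<phi> a else 0)"
  define \<psi> where "\<psi> = (\<lambda>a. \<phi>' a + x * \<kappa> a)"
  have "bd s d (K \<union> {f, g}) \<psi> v = bd s d K \<phi> v" for v
  proof -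
    have "bd s d (K \<union> {f, g}) \<psi> v = bd s d (K \<union> {f, g}) \<phi>' v"
      unfolding \<psi>_def bd_add bd_scale using circuit_bd [OF \<kappa>] assms by simp
    also have "\<dots> = bd s d K \<phi>' v" using assms(1) by (intro bd_supp) (auto simp: \<phi>'_def)
    also have "\<dots> = bd s d K \<phi> v" by (intro bd_cong) (auto simp: \<phi>'_def)
    finally show ?thesis .
  qed
  moreover have "\<not> 3 dvd \<psi> a" if "a \<in> K \<union> {f, g}" for a
    using that x \<phi>(1) \<kappa> pm assms(3-5)
    by (cases "a = e"; cases "a \<in> {f, g}") (auto simp: \<psi>_def \<phi>'_def circuit_def)
  ultimately show ?thesis using \<phi>(2) by (intro z3flowI [of _ \<psi>]) auto
qed

text \<open>The zero moves from \<open>e\<close> to \<open>f\<close> across a triangle, and the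
  values off the triangle stay fixed; this locality is what later arguments exploit.\<close>

lemma rotate_missing_edge:
  fixes \<phi> :: "'e \<Rightarrow> int"
  assumes "finite E" "\<not> z3flow s d E" "\<forall>a\<in>E - {e}. \<not> 3 dvd \<phi> a" "\<forall>v. 3 dvd bd s d E \<phi> v"
    and "triangle e f g" "{e, f, g} \<subseteq> E"
  obtains \<psi> :: "'e \<Rightarrow> int" where "\<forall>a\<in>E - {f}. \<not> 3 dvd \<psi> a" "\<forall>v. 3 dvd bd s d E \<psi> v"
    "\<And>a. a \<notin> {e, f, g} \<Longrightarrow> \<psi> a = \<phi> a"
proof -
  obtain \<kappa> where \<kappa>: "circuit {e, f, g} \<kappa>" using triangle_circuit assms by blast
  note dist = triangle_distinct [OF assms(5)]
  have e0: "3 dvd \<phi> e" using assms(2-4) by (auto simp: z3flow_def)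
  have f0: "\<not> 3 dvd \<phi> f" using assms(3,6) dist by auto
  have pm: "\<kappa> e = 1 \<or> \<kappa> e = -1" "\<kappa> f = 1 \<or> \<kappa> f = -1" "\<kappa> g = 1 \<or> \<kappa> g = -1"
    using \<kappa> by (auto simp: circuit_def)
  \<comment> \<open>Chosen so that \<open>\<psi> x\<close> vanishes on \<open>f\<close>, because
    \<open>\<kappa> f\<close> squares to 1.\<close>
  define x where "x = - \<phi> f * \<kappa> f"
  define \<psi> where "\<psi> = (\<lambda>c a. \<phi> a + c * \<kappa> a)"
  have bd: "bd s d E (\<psi> c) v = bd s d E \<phi> v" for c v
    unfolding \<psi>_def bd_add bd_scale using circuit_bd [OF \<kappa> assms(6,1)] by simp
  have off: "\<psi> c a = \<phi> a" if "a \<notin> {e, f, g}" for a c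
    using \<kappa> that by (auto simp: \<psi>_def circuit_def)
  have e1: "\<not> 3 dvd \<psi> x e" "\<not> 3 dvd \<psi> (- x) e"
    using e0 f0 pm(1,2) unfolding \<psi>_def x_def by (elim disjE; simp; presburger)+
  \<comment> \<open>If \<open>\<psi> x\<close> vanished on \<open>g\<close> as well, the opposite
    shift would double the values on \<open>f\<close> and \<open>g\<close> mod 3 and be nonzero
    everywhere.\<close>
  have g1: "\<not> 3 dvd \<psi> x g"
  proof
    assume g: "3 dvd \<psi> x g"
    have "\<not> 3 dvd \<phi> g" using assms(3,6) dist by auto
    moreover have "\<psi> (- x) g = 2 * \<phi> g - \<psi> x g" by (simp add: \<psi>_def)
    ultimately have "\<not> 3 dvd \<psi> (- x) g" using g by presburger
    moreover have "\<psi> (- x) f = 2 * \<phi> f" using pm(2) by (auto simp: \<psi>_def x_def)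
    then have "\<not> 3 dvd \<psi> (- x) f" using f0 by presburger
    ultimately have "\<forall>a\<in>E. \<not> 3 dvd \<psi> (- x) a"
      using e1 off assms(3) by (metis DiffI insertE singletonD)
    then show False using assms(2,4) bd by (metis z3flow_def)
  qed
  have "\<forall>a\<in>E - {f}. \<not> 3 dvd \<psi> x a"
    using e1 g1 off assms(3) by (metis DiffD1 DiffD2 DiffI insertE insertI1 singletonD)
  then show ?thesis using that [of "\<psi> x"] bd off assms(4) by simp
qed

end

section \<open>Wheels\<close>

text \<open>A path of least length repeats no vertex, since the segment between two occurrences
  could be cut out.\<close>

lemma rtrancl_simple_path:
  assumes "(a, b) \<in> R\<^sup>*"
  obtains n f where "f 0 = a" "f n = b" "\<And>i. i < n \<Longrightarrow> (f i, f (Suc i)) \<in> R" "inj_on f {..n::nat}"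
proof -
  define n where "n = (LEAST n. (a, b) \<in> R ^^ n)"
  have "(a, b) \<in> R ^^ n"
    using assms unfolding n_def rtrancl_power by (rule LeastI_ex)
  then obtain f where f: "f 0 = a" "f n = b" "\<And>i. i < n \<Longrightarrow> (f i, f (Suc i)) \<in> R"
    by (auto simp: relpow_fun_conv)
  have "f i \<noteq> f j" if "i < j" "j \<le> n" for i j
  proof
    assume eq: "f i = f j"
    define g where "g = (\<lambda>k. if k \<le> i then f k else f (k + (j - i)))"
    have "(g k, g (Suc k)) \<in> R" if "k < n - (j - i)" for k
    proof (cases "k = i")
      case True
      then show ?thesis using eq f(3) [of j] that \<open>i < j\<close> by (simp add: g_def)
    next
      case False
      then show ?thesis using f(3) [of k] f(3) [of "k + (j - i)"] that \<open>i < j\<close> \<open>j \<le> n\<close>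
        by (auto simp: g_def)
    qed
    moreover have "g 0 = a" using f(1) by (simp add: g_def)
    moreover have "g (n - (j - i)) = b"
    proof (cases "j = n")
      case True
      then show ?thesis using f(2) eq that by (simp add: g_def)
    next
      case False
      then show ?thesis using f(2) that by (auto simp: g_def)
    qed
    ultimately have "(a, b) \<in> R ^^ (n - (j - i))"
      unfolding relpow_fun_conv by blast
    then have "n \<le> n - (j - i)" unfolding n_def by (rule Least_le)
    then show False using that by linarith
  qed
  then have "inj_on f {..n}"
    by (auto simp: inj_on_def) (metis linorder_neqE_nat)
  then show thesis using f that by blast
qed

text \<open>Here \<open>y\<close> will be the rim values of a wheel and the forbidden sums its
  spokes. If all \<delta> vanish mod 3, the signs must alternate, which needs even \<open>n\<close>;
  otherwise a nonzero \<open>\<delta> k\<close> gives the freedom to close the cycle.\<close>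

lemma cyclic_signs:
  fixes \<delta> :: "nat \<Rightarrow> int"
  assumes "even n \<or> (\<exists>k<n. \<not> 3 dvd \<delta> k)"
  shows "\<exists>y::nat \<Rightarrow> int. \<forall>i<n. y i \<in> {1, -1} \<and> \<not> 3 dvd y (Suc i mod n) - y i + \<delta> i"
proof (cases "\<exists>k<n. \<not> 3 dvd \<delta> k")
  case False
  define y :: "nat \<Rightarrow> int" where "y = (\<lambda>i. (-1) ^ i)"
  have "y (Suc i mod n) = - y i" if "i < n" for i
    using that assms False by (cases "Suc i = n") (auto simp: y_def)
  moreover have y: "y i \<in> {1, -1}" for i by (cases "even i") (auto simp: y_def)
  moreover have "\<not> 3 dvd - t - t + r" if "t \<in> {1, -1}" "3 dvd r" for t r :: int
    using that by (elim insertE emptyE; simp; presburger)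
  ultimately show ?thesis using False by (intro exI [of _ y]) auto
next
  case True
  then obtain k where k: "k < n" "\<not> 3 dvd \<delta> k" by blast
  \<comment> \<open>After the sign \<open>a\<close> at most one of the two signs is
    forbidden.\<close>
  define nxt where "nxt = (\<lambda>a r::int. if \<not> 3 dvd 1 - a + r then 1 else -1 :: int)"
  have nxt: "nxt a r \<in> {1, -1}" "\<not> 3 dvd nxt a r - a + r" for a r
    by (auto simp: nxt_def, presburger+)
  \<comment> \<open>Signs are chosen greedily from position \<open>k + 1\<close> on, so that the
    condition at \<open>k\<close> closes the cycle. The start is congruent to
    \<open>- \<delta> k\<close>, which satisfies this condition whatever the last sign is.\<close>
  define z where "z = rec_nat (if 3 dvd \<delta> k - 1 then -1 else 1)
    (\<lambda>i a. nxt a (\<delta> ((k + 1 + i) mod n)))"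
  have z0: "z 0 = (if 3 dvd \<delta> k - 1 then -1 else 1)" by (simp add: z_def)
  have zS: "z (Suc i) = nxt (z i) (\<delta> ((k + 1 + i) mod n))" for i by (simp add: z_def)
  have z1: "z i \<in> {1, -1}" for i
    using nxt(1) by (cases i) (simp_all only: z0 zS, simp)
  define y where "y = (\<lambda>j. if j \<le> k then z (j + n - (k + 1)) else z (j - (k + 1)))"
  have "\<not> 3 dvd y (Suc i mod n) - y i + \<delta> i" if "i < n" for i
  proof (cases "i = k")
    case True
    have "y (Suc k mod n) = z 0"
      using k(1) by (cases "Suc k = n") (auto simp: y_def)
    moreover have "y k = z (n - 1)" by (simp add: y_def)
    moreover have "\<not> 3 dvd z 0 - t + \<delta> k" if "t \<in> {1, -1}" for t
      using that k(2) unfolding z0 by (elim insertE emptyE; simp; presburger)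
    ultimately show ?thesis using z1 True by simp
  next
    case False
    have "\<exists>j. y i = z j \<and> y (Suc i mod n) = z (Suc j) \<and> (k + 1 + j) mod n = i"
    proof (cases "i < k")
      case True
      moreover have "Suc (i + n - Suc k) = i + n - k" using k(1) by simp
      ultimately show ?thesis using k(1)
        by (intro exI [of _ "i + n - (k + 1)"]) (auto simp: y_def Suc_diff_le)
    next
      case F: False
      then have "k < i" using False by simp
      moreover from this have "Suc (i - Suc k) = i - k" by simp
      ultimately show ?thesis using \<open>i < n\<close> k(1)
        by (intro exI [of _ "i - (k + 1)"]; cases "Suc i = n") (auto simp: y_def Suc_diff_le)
    qed
    then show ?thesis using zS nxt(2) by metis
  qed
  then show ?thesis using z1 by (intro exI [of _ y]) (auto simp: y_def)
qed

context loopless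
begin

definition wheel :: "nat \<Rightarrow> 'v \<Rightarrow> (nat \<Rightarrow> 'v) \<Rightarrow> (nat \<Rightarrow> 'e) \<Rightarrow> (nat \<Rightarrow> 'e) \<Rightarrow> bool" where
  "wheel n h v sp rm \<longleftrightarrow> n \<ge> 3 \<and> inj_on v {..<n} \<and> h \<notin> v ` {..<n} \<and>
     (\<forall>i<n. ends (sp i) = {h, v i} \<and> ends (rm i) = {v i, v (Suc i mod n)})"

definition wedges :: "nat \<Rightarrow> (nat \<Rightarrow> 'e) \<Rightarrow> (nat \<Rightarrow> 'e) \<Rightarrow> 'e set" where
  "wedges n sp rm = sp ` {..<n} \<union> rm ` {..<n}"

definition sqrt3flow :: "'e set \<Rightarrow> 'e \<Rightarrow> bool" where
  "sqrt3flow E e \<longleftrightarrow> (\<exists>f::'e \<Rightarrow> complex. (\<forall>v. bd s d E f v = 0) \<and>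
     (\<forall>a\<in>E - {e}. cmod (f a) = 1) \<and> cmod (f e) = sqrt 3)"

section \<open>Flows on a wheel\<close>

lemma finite_wedges [simp]: "finite (wedges n sp rm)"
  by (simp add: wedges_def)

lemma wheel_ends_inj:
  assumes "wheel n h v sp rm" "i < n" "j < n"
  shows "ends (sp i) = ends (sp j) \<Longrightarrow> i = j" "ends (rm i) = ends (rm j) \<Longrightarrow> i = j"
    "ends (sp i) \<noteq> ends (rm j)"
proof -
  have n: "n \<ge> 3" and v: "\<And>i j. i < n \<Longrightarrow> j < n \<Longrightarrow> v i = v j \<longleftrightarrow> i = j" "\<And>i. i < n \<Longrightarrow> h \<noteq> v i"
    and e: "\<And>i. i < n \<Longrightarrow> ends (sp i) = {h, v i}" "\<And>i. i < n \<Longrightarrow> ends (rm i) = {v i, v (Suc i mod n)}"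
    using assms(1) by (auto simp: wheel_def inj_on_def)
  have nx: "Suc i mod n < n" for i using n by simp
  show "i = j" if "ends (sp i) = ends (sp j)"
    using that assms(2,3) v by (auto simp: e doubleton_eq_iff)
  show "i = j" if "ends (rm i) = ends (rm j)"
  proof -
    have "i = j \<or> (i = Suc j mod n \<and> Suc i mod n = j)"
      using that assms(2,3) nx v(1) by (auto simp: e doubleton_eq_iff)
    then show ?thesis using assms(2,3) n by (auto simp: mod_Suc split: if_splits)
  qed
  show "ends (sp i) \<noteq> ends (rm j)"
    using assms(2,3) v(2) [of j] v(2) [OF nx, of j] by (auto simp: e)
qed

lemma wheel_inj:
  assumes "wheel n h v sp rm"
  shows "inj_on sp {..<n}" "inj_on rm {..<n}" "sp ` {..<n} \<inter> rm ` {..<n} = {}"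
proof -
  show "inj_on sp {..<n}" using wheel_ends_inj(1) [OF assms] by (simp add: inj_on_def)
  show "inj_on rm {..<n}" using wheel_ends_inj(2) [OF assms] by (simp add: inj_on_def)
  have "sp i \<noteq> rm j" if "i < n" "j < n" for i j
    using wheel_ends_inj(3) [OF assms that] by metis
  then show "sp ` {..<n} \<inter> rm ` {..<n} = {}" by auto
qed

text \<open>A superposition of circulations: \<open>\<rho> i\<close> is the strength around the
  triangle at \<open>rm i\<close>. A rim edge lies in one of these triangles, a spoke in two, where
  it is traversed in opposite directions.\<close>

lemma wheel_flow:
  fixes \<rho> :: "nat \<Rightarrow> 'a::comm_ring_1"
  assumes W: "wheel n h v sp rm"
  obtains f where "\<And>i. i < n \<Longrightarrow> f (rm i) = dir (rm i) (v i) * \<rho> i"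
    "\<And>i. i < n \<Longrightarrow> f (sp (Suc i mod n)) = dir (sp (Suc i mod n)) h * (\<rho> (Suc i mod n) - \<rho> i)"
    "\<And>x. bd s d (wedges n sp rm) f x = 0"
proof -
  \<comment> \<open>The cyclic predecessor; adding \<open>n\<close> avoids truncated subtraction at
    0.\<close>
  define pr where "pr = (\<lambda>i. (i + n - 1) mod n)"
  have n: "n \<ge> 3" using W by (simp add: wheel_def)
  have prnx: "pr (Suc i mod n) = i" if "i < n" for i
    using that by (cases "Suc i = n") (auto simp: pr_def)
  note inj = wheel_inj [OF W]
  define f where "f = (\<lambda>e. if e \<in> sp ` {..<n}
     then dir e h * (\<rho> (the_inv_into {..<n} sp e) - \<rho> (pr (the_inv_into {..<n} sp e)))
     else dir e (v (the_inv_into {..<n} rm e)) * \<rho> (the_inv_into {..<n} rm e))"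
  have fsp: "f (sp i) = dir (sp i) h * (\<rho> i - \<rho> (pr i))" if "i < n" for i
    using that inj(1) by (simp add: f_def the_inv_into_f_f)
  have frm: "f (rm i) = dir (rm i) (v i) * \<rho> i" if "i < n" for i
  proof -
    have "rm i \<notin> sp ` {..<n}" using inj(3) that by blast
    then show ?thesis using that inj(2) by (simp add: f_def the_inv_into_f_f)
  qed
  have "bd s d (wedges n sp rm) f x = 0" for x
  proof -
    let ?D = "\<lambda>i. of_bool (h = x) - of_bool (v i = x) :: 'a"
    let ?I = "\<lambda>e. of_bool (s e = x) - of_bool (d e = x) :: 'a"
    have bij: "bij_betw (\<lambda>i. Suc i mod n) {..<n} {..<n}"
    proof -
      have "inj_on (\<lambda>i. Suc i mod n) {..<n}" using prnx by (intro inj_on_inverseI [of _ pr]) auto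
      moreover have "(\<lambda>i. Suc i mod n) ` {..<n} \<subseteq> {..<n}" using n by auto
      ultimately show ?thesis by (simp add: bij_betw_def endo_inj_surj)
    qed
    have "bd s d (wedges n sp rm) f x = (\<Sum>i<n. f (sp i) * ?I (sp i)) + (\<Sum>i<n. f (rm i) * ?I (rm i))"
      unfolding bd_def wedges_def using inj by (simp add: sum.union_disjoint sum.reindex)
    also have "(\<Sum>i<n. f (sp i) * ?I (sp i)) = (\<Sum>i<n. (\<rho> i - \<rho> (pr i)) * ?D i)"
    proof (rule sum.cong)
      fix i assume "i \<in> {..<n}"
      then have i: "i < n" by simp
      then have "ends (sp i) = {h, v i}" using W by (simp add: wheel_def)
      then show "f (sp i) * ?I (sp i) = (\<rho> i - \<rho> (pr i)) * ?D i"
        using arg_cong [OF dir_bd [of "sp i" h "v i" x], of "\<lambda>c. (\<rho> i - \<rho> (pr i)) * c"]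
        unfolding fsp [OF i] by (simp only: mult.assoc mult.commute mult.left_commute)
    qed simp
    also have "\<dots> = (\<Sum>i<n. \<rho> i * ?D i) - (\<Sum>i<n. \<rho> (pr i) * ?D i)"
      by (simp add: left_diff_distrib sum_subtractf)
    \<comment> \<open>The cyclic shift turns \<open>\<rho> (pr i)\<close> into
      \<open>\<rho> i\<close>, so that spokes and rim cancel termwise.\<close>
    also have "(\<Sum>i<n. \<rho> (pr i) * ?D i) = (\<Sum>i<n. \<rho> (pr (Suc i mod n)) * ?D (Suc i mod n))"
      using sum.reindex_bij_betw [OF bij, of "\<lambda>i. \<rho> (pr i) * ?D i"] by simp
    also have "\<dots> = (\<Sum>i<n. \<rho> i * ?D (Suc i mod n))"
      by (intro sum.cong) (simp_all add: prnx)
    also have "(\<Sum>i<n. f (rm i) * ?I (rm i)) = (\<Sum>i<n. \<rho> i * (?D (Suc i mod n) - ?D i))"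
    proof (rule sum.cong)
      fix i assume "i \<in> {..<n}"
      then have i: "i < n" by simp
      then have "ends (rm i) = {v i, v (Suc i mod n)}" using W by (simp add: wheel_def)
      then have "dir (rm i) (v i) * ?I (rm i) = ?D (Suc i mod n) - ?D i"
        by (simp add: dir_bd)
      then show "f (rm i) * ?I (rm i) = \<rho> i * (?D (Suc i mod n) - ?D i)"
        unfolding frm [OF i] 
        by (simp only: mult.assoc mult.left_commute [of _ "\<rho> i"])
    qed simp
    finally show ?thesis
      by (simp add: right_diff_distrib sum_subtractf)
  qed
  moreover have "f (sp (Suc i mod n)) = dir (sp (Suc i mod n)) h * (\<rho> (Suc i mod n) - \<rho> i)" if "i < n" for i
  proof -
    have "Suc i mod n < n" using n by simp
    then show ?thesis by (simp add: fsp prnx that)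
  qed
  ultimately show thesis using that frm by blast
qed

lemma wheel_edge_cases:
  assumes "n \<ge> 1" "e \<in> wedges n sp rm"
  obtains i where "i < n" "e = rm i" | i where "i < n" "e = sp (Suc i mod n)"
proof -
  have "\<exists>i<n. j = Suc i mod n" if "j < n" for j
    using that by (intro exI [of _ "if j = 0 then n - 1 else j - 1"]) auto
  then show thesis using assms(2) that by (auto simp: wedges_def)
qed

text \<open>Circulations make the rim values arbitrary signs \<open>y\<close>; the spokes then carry
  the differences of \<open>y\<close> plus \<delta>, the spoke values left once the rim values of
  \<phi> are cancelled. If every \<delta> is 0 mod 3, then \<phi> is itself a circulation mod 3, so
  \<open>nz\<close> leaves only even \<open>n\<close>.\<close>

lemma wheel_realise:
  fixes \<phi> :: "'e \<Rightarrow> int"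
  assumes W: "wheel n h v sp rm"
    and nz: "even n \<or> (\<exists>x. \<not> 3 dvd bd s d (wedges n sp rm) \<phi> x)"
  shows "\<exists>\<psi>::'e \<Rightarrow> int. (\<forall>e\<in>wedges n sp rm. \<not> 3 dvd \<psi> e) \<and>
    (\<forall>x. 3 dvd bd s d (wedges n sp rm) \<psi> x - bd s d (wedges n sp rm) \<phi> x)"
proof -
  have n: "n \<ge> 3" and n1: "n \<ge> 1" using W by (simp_all add: wheel_def)
  have dd: "dir e x * (dir e x * c) = (c::int)" for e x c by (simp add: dir_def)
  have d3: "3 dvd dir e x * c \<longleftrightarrow> 3 dvd c" for e x and c :: int by (simp add: dir_def)
  define a where "a = (\<lambda>i. dir (rm i) (v i) * \<phi> (rm i))"
  define b where "b = (\<lambda>i. dir (sp i) h * \<phi> (sp i))"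
  define \<delta> where "\<delta> = (\<lambda>i. b (Suc i mod n) - a (Suc i mod n) + a i)"
  have \<phi>a: "\<phi> (rm i) = dir (rm i) (v i) * a i" and \<phi>b: "\<phi> (sp i) = dir (sp i) h * b i" for i
    by (simp_all add: a_def b_def dd)
  have signs: "even n \<or> (\<exists>k<n. \<not> 3 dvd \<delta> k)"
  proof (rule ccontr)
    assume "\<not> ?thesis"
    then have \<delta>0: "\<And>k. k < n \<Longrightarrow> 3 dvd \<delta> k" and "odd n" by auto
    obtain f where f: "\<And>i. i < n \<Longrightarrow> f (rm i) = dir (rm i) (v i) * (- a i)"
      "\<And>i. i < n \<Longrightarrow> f (sp (Suc i mod n)) = dir (sp (Suc i mod n)) h * (- a (Suc i mod n) - - a i)"
      "\<And>x. bd s d (wedges n sp rm) f x = 0"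
      using wheel_flow [OF W, of "\<lambda>i. - a i"] by metis
    have "3 dvd \<phi> e + f e" if "e \<in> wedges n sp rm" for e
    proof (cases rule: wheel_edge_cases [OF n1 that])
      case (2 i)
      have "\<phi> e + f e = dir e h * \<delta> i"
        unfolding 2 \<phi>b f(2) [OF 2(1)] \<delta>_def by (simp add: algebra_simps)
      then show ?thesis using \<delta>0 [OF 2(1)] by simp
    qed (use f \<phi>a in auto)
    then have "3 dvd bd s d (wedges n sp rm) (\<lambda>e. \<phi> e + f e) x" for x
      unfolding bd_def by (intro dvd_sum) auto
    then show False using nz f(3) \<open>odd n\<close> by (simp add: bd_add)
  qed
  obtain y :: "nat \<Rightarrow> int" where "\<forall>i<n. y i \<in> {1, -1} \<and> \<not> 3 dvd y (Suc i mod n) - y i + \<delta> i"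
    using cyclic_signs [OF signs] by (elim exE)
  then have y: "\<And>i. i < n \<Longrightarrow> y i \<in> {1, -1}"
    "\<And>i. i < n \<Longrightarrow> \<not> 3 dvd y (Suc i mod n) - y i + \<delta> i" by simp_all
  obtain f where f: "\<And>i. i < n \<Longrightarrow> f (rm i) = dir (rm i) (v i) * (y i - a i)"
      "\<And>i. i < n \<Longrightarrow> f (sp (Suc i mod n)) =
         dir (sp (Suc i mod n)) h * ((y (Suc i mod n) - a (Suc i mod n)) - (y i - a i))"
      "\<And>x. bd s d (wedges n sp rm) f x = 0"
    using wheel_flow [OF W, of "\<lambda>i. y i - a i"] by metis
  have "\<not> 3 dvd \<phi> e + f e" if "e \<in> wedges n sp rm" for e
  proof (cases rule: wheel_edge_cases [OF n1 that])
    case (1 i)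
    have "\<phi> e + f e = dir e (v i) * y i"
      unfolding 1 \<phi>a f(1) [OF 1(1)] by (simp add: algebra_simps)
    then show ?thesis using y(1) [OF 1(1)] by (auto simp: d3)
  next
    case (2 i)
    have "\<phi> e + f e = dir e h * (y (Suc i mod n) - y i + \<delta> i)"
      unfolding 2 \<phi>b f(2) [OF 2(1)] \<delta>_def by (simp add: algebra_simps)
    then show ?thesis using y(2) [OF 2(1)] by (simp add: d3)
  qed
  then show ?thesis
    by (intro exI [of _ "\<lambda>e. \<phi> e + f e"]) (simp add: bd_add f(3))
qed

lemma wheel_rotate:
  assumes "wheel n h v sp rm"
  shows "wheel n h (\<lambda>i. v ((i + k) mod n)) (\<lambda>i. sp ((i + k) mod n)) (\<lambda>i. rm ((i + k) mod n))"
    "wedges n (\<lambda>i. sp ((i + k) mod n)) (\<lambda>i. rm ((i + k) mod n)) = wedges n sp rm"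
proof -
  have n: "n \<ge> 3" using assms by (simp add: wheel_def)
  have "i \<le> j" if "i < n" "(i + k) mod n = (j + k) mod n" for i j
  proof (rule ccontr)
    assume "\<not> i \<le> j"
    then have "n dvd i - j" using that mod_eq_dvd_iff_nat [of "j + k" "i + k" n] by simp
    then show False using that \<open>\<not> i \<le> j\<close> by (auto dest: dvd_imp_le)
  qed
  then have inj: "inj_on (\<lambda>i. (i + k) mod n) {..<n}"
    by (metis (mono_tags, lifting) inj_onI le_antisym lessThan_iff)
  moreover have "(\<lambda>i. (i + k) mod n) ` {..<n} \<subseteq> {..<n}" using n by auto
  ultimately have im: "(\<lambda>i. (i + k) mod n) ` {..<n} = {..<n}" by (simp add: endo_inj_surj)
  have eq: "(\<lambda>i. g ((i + k) mod n)) ` {..<n} = g ` {..<n}" for g :: "nat \<Rightarrow> 'z"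
    using im by (metis image_image)
  show "wedges n (\<lambda>i. sp ((i + k) mod n)) (\<lambda>i. rm ((i + k) mod n)) = wedges n sp rm"
    by (simp add: wedges_def eq)
  have "inj_on (\<lambda>i. v ((i + k) mod n)) {..<n}"
    using comp_inj_on [OF inj, of v] im assms by (simp add: wheel_def comp_def)
  then show "wheel n h (\<lambda>i. v ((i + k) mod n)) (\<lambda>i. sp ((i + k) mod n)) (\<lambda>i. rm ((i + k) mod n))"
    using assms by (auto simp: wheel_def eq mod_simps)
qed

text \<open>Triangle strengths are built from a primitive sixth root of unity \<open>z\<close>, so
  that consecutive ones mostly differ by unit vectors; the mismatch of going around an odd cycle is
  collected in one edge, rotated to index 0.\<close>

lemma wheel_sqrt3flow:
  assumes W: "wheel n h v sp rm" and "odd n" and e: "e \<in> wedges n sp rm"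
  shows "sqrt3flow (wedges n sp rm) e"
proof -
  define z where "z = Complex (1/2) (sqrt 3 / 2)"
  have z: "cmod z = 1" "cmod (1 - z) = 1" "cmod (z - 1) = 1" "cmod (z^2 - z) = 1" "cmod (z - z^2) = 1"
    "cmod (z^2) = 1" "cmod (1 - z^2) = sqrt 3" "cmod (1 + z) = sqrt 3"
    by (simp_all add: z_def cmod_def complex_eq_iff power2_eq_square field_simps)
  have n: "n \<ge> 3" and n1: "n \<ge> 1" using W by (simp_all add: wheel_def)
  have dirn: "cmod (dir a x * c) = cmod c" for a x c by (simp add: dir_def)
  have main: "sqrt3flow (wedges n sp' rm') a"
    if W': "wheel n h v' sp' rm'" and a: "a = sp' 0 \<or> a = rm' 0" for v' sp' rm' a
  proof -
    \<comment> \<open>If \<open>a\<close> is a spoke, the last index \<open>n - 1\<close> is even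
      and the jump back is \<open>1 - z^2\<close>. If \<open>a\<close> is a rim edge,
      \<open>1 + z\<close> has length sqrt 3 and differs by a unit vector from both neighbouring
      strengths \<open>z\<close> and 1.\<close>
    define \<rho> where "\<rho> = (\<lambda>i::nat. if a = sp' 0 then (if i = 0 then 1 else if odd i then z else z^2)
      else (if i = 0 then 1 + z else if odd i then z else 1))"
    obtain f where f: "\<And>i. i < n \<Longrightarrow> f (rm' i) = dir (rm' i) (v' i) * \<rho> i"
      "\<And>i. i < n \<Longrightarrow> f (sp' (Suc i mod n)) = dir (sp' (Suc i mod n)) h * (\<rho> (Suc i mod n) - \<rho> i)"
      "\<And>x. bd s d (wedges n sp' rm') f x = 0"
      using wheel_flow [OF W', of \<rho>] by metis
    note inj = wheel_inj [OF W']
    have ne: "rm' i \<noteq> sp' j" if "i < n" "j < n" for i j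
    proof -
      have "rm' i \<in> rm' ` {..<n}" "sp' j \<in> sp' ` {..<n}" using that by simp_all
      then show ?thesis using inj(3) by (metis disjoint_iff)
    qed
    have n0: "0 < n" using n by simp
    have rm: "cmod (\<rho> i) = (if rm' i = a then sqrt 3 else 1)" if "i < n" for i
    proof -
      have "rm' i = a \<longleftrightarrow> a \<noteq> sp' 0 \<and> i = 0"
        using a inj(2) ne [OF that n0] ne [OF n0 n0] that n0 by (auto simp: inj_on_def)
      then show ?thesis using z by (auto simp: \<rho>_def)
    qed
    have sp: "cmod (\<rho> (Suc i mod n) - \<rho> i) = (if sp' (Suc i mod n) = a then sqrt 3 else 1)" if "i < n" for i
    proof -
      have lt: "Suc i mod n < n" using n by simp
      have "sp' (Suc i mod n) = a \<longleftrightarrow> a = sp' 0 \<and> Suc i mod n = 0"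
        using a inj(1) ne [OF n0 lt] ne [OF n0 n0] lt n0 by (auto simp: inj_on_def)
      moreover have "Suc i mod n = 0 \<longleftrightarrow> Suc i = n" using that by (auto simp: mod_Suc)
      moreover have "i \<noteq> 0" "even i" if "Suc i = n" using that n \<open>odd n\<close> by auto
      ultimately show ?thesis using z that by (cases "Suc i = n") (auto simp: \<rho>_def)
    qed
    have "cmod (f b) = (if b = a then sqrt 3 else 1)" if "b \<in> wedges n sp' rm'" for b
    proof (cases rule: wheel_edge_cases [OF n1 that])
      case (1 i)
      then show ?thesis using rm [OF 1(1)] f(1) [OF 1(1)] by (simp add: dirn)
    next
      case (2 i)
      then show ?thesis using sp [OF 2(1)] f(2) [OF 2(1)] by (simp add: dirn)
    qed
    moreover have "a \<in> wedges n sp' rm'" using a n by (auto simp: wedges_def)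
    ultimately show ?thesis unfolding sqrt3flow_def using f(3) by (intro exI [of _ f]) auto
  qed
  obtain k where k: "k < n" "e = sp k \<or> e = rm k" using e by (auto simp: wedges_def)
  then show ?thesis
    using main [OF wheel_rotate(1) [OF W, of k], of e] wheel_rotate(2) [OF W, of k] by simp
qed

text \<open>The disjointness premise says that the common end of the two new edges is a new
  vertex.\<close>

inductive twotree :: "'e set \<Rightarrow> bool" where
  single: "twotree {e}"
| grow: "twotree K \<Longrightarrow> e \<in> K \<Longrightarrow> triangle e f g \<Longrightarrow> ends f \<inter> ends g \<inter> (\<Union>a\<in>K. ends a) = {} \<Longrightarrow>
    twotree (K \<union> {f, g})"

lemma triangle_third:
  assumes "triangle a b c" "ends a = {p, u}" "ends b = {p, w}"
  shows "ends c = {u, w}" "u \<noteq> w"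
  using assms ends_neq [OF assms(2)] ends_neq [OF assms(3)]
  by (auto simp: triangle_def doubleton_eq_iff)

lemma twotree_finite: "twotree K \<Longrightarrow> finite K"
  by (induction rule: twotree.induct) auto

lemma tricon_extend:
  assumes "tricon K" "e \<in> K" "triangle e f g"
  shows "tricon (K \<union> {f, g})"
proof (rule triconI)
  fix a assume a: "a \<in> K \<union> {f, g}"
  have "(trel K)\<^sup>* \<subseteq> (trel (K \<union> {f, g}))\<^sup>*" by (intro rtrancl_mono trel_mono) auto
  moreover have "(f, e) \<in> trel (K \<union> {f, g})" "(g, e) \<in> trel (K \<union> {f, g})"
    using assms(2) triangle_perms [OF assms(3)] by (auto intro: triangle_trel)
  ultimately show "(a, e) \<in> (trel (K \<union> {f, g}))\<^sup>*"
    using a assms(1,2) unfolding tricon_def by blast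
qed

lemma twotree_tricon: "twotree K \<Longrightarrow> tricon K"
proof (induction rule: twotree.induct)
  case (single e)
  then show ?case by (simp add: tricon_def)
qed (rule tricon_extend)

lemma new_edges_notin:
  assumes "triangle e f g" "ends f \<inter> ends g \<inter> (\<Union>a\<in>K. ends a) = {}"
  shows "f \<notin> K" "g \<notin> K"
proof -
  obtain z where "z \<in> ends f" "z \<in> ends g" using assms(1) by (auto simp: triangle_def)
  then show "f \<notin> K" "g \<notin> K" using assms(2) by auto
qed

lemma twotree_z3flow: "twotree K \<Longrightarrow> (\<exists>e. K = {e}) \<or> z3flow s d K"
proof (induction rule: twotree.induct)
  case (grow K e f g)
  then show ?case
    using z3flow_ear [of K e f g] new_edges_notin [of e f g K] twotree_tricon twotree_finite by blast
qed simp

text \<open>Adjacency in the link of \<open>p\<close>, whose vertices are represented by the edges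
  at \<open>p\<close>; a path in the link is a fan of triangles around \<open>p\<close>.\<close>

definition lrel :: "'e set \<Rightarrow> 'v \<Rightarrow> ('e \<times> 'e) set" where
  "lrel K p = {(a, b). a \<in> K \<and> b \<in> K \<and> p \<in> ends a \<and> p \<in> ends b \<and> (\<exists>c\<in>K. triangle a b c)}"

lemma lrel_sym: "(a, b) \<in> (lrel K p)\<^sup>* \<Longrightarrow> (b, a) \<in> (lrel K p)\<^sup>*"
proof -
  have "sym (lrel K p)" by (rule symI) (auto simp: lrel_def dest: triangle_swap12)
  then show "(a, b) \<in> (lrel K p)\<^sup>* \<Longrightarrow> (b, a) \<in> (lrel K p)\<^sup>*" by (meson sym_rtrancl symD)
qed

text \<open>The link of the new vertex is the pair \<open>f\<close>, \<open>g\<close>; in the link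
  of an end of \<open>e\<close>, the new edge hangs on \<open>e\<close>.\<close>

lemma twotree_link_connected:
  "twotree K \<Longrightarrow> a \<in> K \<Longrightarrow> b \<in> K \<Longrightarrow> p \<in> ends a \<Longrightarrow> p \<in> ends b \<Longrightarrow> (a, b) \<in> (lrel K p)\<^sup>*"
proof (induction arbitrary: a b p rule: twotree.induct)
  case (grow K e f g)
  let ?K = "K \<union> {f, g}"
  obtain x y z where xyz: "ends e = {x, y}" "ends f = {y, z}" "ends g = {x, z}"
    "x \<noteq> y" "y \<noteq> z" "x \<noteq> z" using grow.hyps(3) by (auto simp: triangle_def)
  have zK: "z \<notin> ends c" if "c \<in> K" for c
    using grow.hyps(4) xyz that by auto
  note perms = triangle_perms [OF grow.hyps(3)]
  show ?case
  proof (cases "p = z")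
    case True
    then have "a \<in> {f, g}" "b \<in> {f, g}" using grow.prems zK by auto
    moreover have "(f, g) \<in> lrel ?K z" "(g, f) \<in> lrel ?K z"
      using perms xyz grow.hyps(2) by (auto simp: lrel_def)
    ultimately show ?thesis using True by auto
  next
    case False
    have rep: "\<exists>c'\<in>K. p \<in> ends c' \<and> (c, c') \<in> (lrel ?K p)\<^sup>*" if "c \<in> ?K" "p \<in> ends c" for c
    proof (cases "c \<in> K")
      case F: False
      then have "c = f \<and> p = y \<or> c = g \<and> p = x" using that xyz False by auto
      then have "(c, e) \<in> lrel ?K p" "p \<in> ends e"
        using perms xyz grow.hyps(2) by (auto simp: lrel_def)
      then show ?thesis using grow.hyps(2) by blast
    qed (use that in auto)
    obtain a' b' where "a' \<in> K" "p \<in> ends a'" "(a, a') \<in> (lrel ?K p)\<^sup>*"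
      "b' \<in> K" "p \<in> ends b'" "(b, b') \<in> (lrel ?K p)\<^sup>*"
      using rep grow.prems by meson
    moreover have "lrel K p \<subseteq> lrel ?K p" by (auto simp: lrel_def)
    ultimately show ?thesis
      using grow.IH rtrancl_mono lrel_sym by (meson rtrancl_trans subsetD)
  qed
qed simp

text \<open>Edges related by \<open>trel\<close> share an end, so a chain of them contains a route
  from \<open>x\<close> to \<open>z\<close> along which one unit can be sent.\<close>

lemma tricon_path:
  assumes "tricon K" "finite K" "a \<in> K" "b \<in> K" "x \<in> ends a" "z \<in> ends b"
  shows "\<exists>\<theta>::'e \<Rightarrow> int. \<forall>v. bd s d K \<theta> v = of_bool (x = v) - of_bool (z = v)"
proof -
  let ?L = "\<lambda>x z. \<exists>\<theta>::'e \<Rightarrow> int. \<forall>v. bd s d K \<theta> v = of_bool (x = v) - of_bool (z = v)"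
  have trans: "?L x z" if xy: "?L x y" and yz: "?L y z" for x y z
  proof -
    obtain \<theta> \<eta> :: "'e \<Rightarrow> int" where "\<forall>v. bd s d K \<theta> v = of_bool (x = v) - of_bool (y = v)"
      "\<forall>v. bd s d K \<eta> v = of_bool (y = v) - of_bool (z = v)" using xy yz by blast
    then have "\<forall>v. bd s d K (\<lambda>e. \<theta> e + \<eta> e) v = of_bool (x = v) - of_bool (z = v)"
      unfolding bd_add by simp
    then show ?thesis by blast
  qed
  have refl: "?L x x" for x by (intro exI [of _ "\<lambda>e. 0"]) simp
  have edge: "?L x z" if "c \<in> K" "x \<in> ends c" "z \<in> ends c" for c x z
  proof (cases "x = z")
    case False
    then have ends: "ends c = {x, z}" using that by (auto simp: ends_def)
    have "bd s d K (\<lambda>e. if e = c then dir c x else 0) v = (of_bool (x = v) - of_bool (z = v) :: int)" for v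
      by (subst bd_supp [of K "{c}"]) (use assms(2) that in \<open>auto simp: bd_def dir_bd [OF ends]\<close>)
    then show ?thesis by blast
  qed (use refl in auto)
  have "(a, b) \<in> (trel K)\<^sup>*" using assms by (auto simp: tricon_def)
  then have "\<forall>z\<in>ends b. ?L x z"
  proof (induction rule: rtrancl_induct)
    case base
    then show ?case using edge assms by blast
  next
    case (step b c)
    then have "c \<in> K" "\<exists>y. y \<in> ends b \<and> y \<in> ends c"
      by (auto simp: trel_def triangle_def) (auto simp: ends_def)
    then show ?case using step.IH edge trans by meson
  qed
  then show ?thesis using assms(6) by blast
qed

text \<open>If both ends of the two new edges are old vertices, the value along the path formed by
  the new edges can be made constant by rerouting through \<open>K\<close>; that path then acts as a second
  copy of \<open>e\<close>.\<close>

lemma closed_ear_realise: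
  fixes \<phi> :: "'e \<Rightarrow> int"
  assumes "finite K" "tricon K" "e \<in> K" "f \<notin> K" "g \<notin> K" "triangle e f g"
    and "z \<in> ends f" "z \<in> ends g" "k \<in> K" "z \<in> ends k"
  shows "\<exists>\<psi>::'e \<Rightarrow> int. (\<forall>a\<in>K \<union> {f, g}. \<not> 3 dvd \<psi> a) \<and>
    (\<forall>v. 3 dvd bd s d (K \<union> {f, g}) \<psi> v - bd s d (K \<union> {f, g}) \<phi> v)"
proof -
  let ?H = "K \<union> {f, g}"
  have fin: "finite ?H" using assms(1) by simp
  obtain x0 y z0 where "ends e = {x0, y}" "ends f = {y, z0}" "ends g = {x0, z0}" "x0 \<noteq> y"
    using assms(6) by (auto simp: triangle_def)
  then have y: "y \<in> ends e" "ends f = {y, z}" using assms(7,8) by auto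
  obtain \<kappa> where \<kappa>: "circuit {e, f, g} \<kappa>" using triangle_circuit assms(6) by blast
  have pm: "\<kappa> e = 1 \<or> \<kappa> e = -1" "\<kappa> f = 1 \<or> \<kappa> f = -1" "\<kappa> g = 1 \<or> \<kappa> g = -1"
    using \<kappa> by (auto simp: circuit_def)
  note dist = triangle_distinct [OF assms(6)]
  obtain \<theta> :: "'e \<Rightarrow> int" where \<theta>: "\<forall>v. bd s d K \<theta> v = of_bool (y = v) - of_bool (z = v)"
    using tricon_path [OF assms(2,1,3,9) y(1) assms(10)] by blast
  \<comment> \<open>A circulation: \<theta> sends one unit from \<open>y\<close> to \<open>z\<close>
    inside \<open>K\<close> and \<open>f\<close> returns it. It misses \<open>g\<close>, so it
    adjusts \<open>f\<close> relative to \<open>g\<close>.\<close>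
  define \<theta>' where "\<theta>' = (\<lambda>a. if a \<in> K then \<theta> a else if a = f then - dir f y else 0)"
  have split: "bd s d ?H \<eta> v = bd s d K \<eta> v + bd s d {f, g} \<eta> v" for \<eta> :: "'e \<Rightarrow> int" and v
    using assms by (intro bd_Un) auto
  have \<theta>': "bd s d ?H \<theta>' v = 0" for v
  proof -
    have "bd s d K \<theta>' v = bd s d K \<theta> v" by (intro bd_cong) (auto simp: \<theta>'_def)
    moreover have "bd s d {f, g} \<theta>' v = - (dir f y * (of_bool (s f = v) - of_bool (d f = v)))"
      using assms(4,5) dist by (auto simp: bd_def \<theta>'_def)
    ultimately show ?thesis unfolding split dir_bd [OF y(2)] using \<theta> by simp
  qed
  \<comment> \<open>Makes the values on \<open>f\<close> and \<open>g\<close> equal up to the signs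
    of \<kappa>, so that adding a multiple of \<kappa> keeps both nonzero or makes both
    vanish.\<close>
  define t where "t = dir f y * (\<phi> f - \<kappa> f * \<kappa> g * \<phi> g)"
  define \<phi>1 where "\<phi>1 = (\<lambda>a. \<phi> a + t * \<theta>' a)"
  have \<phi>1fg: "\<phi>1 f = \<kappa> f * \<kappa> g * \<phi>1 g"
    using assms(4,5) dist by (auto simp: \<phi>1_def \<theta>'_def t_def dir_def)
  have \<phi>1: "bd s d ?H \<phi>1 v = bd s d ?H \<phi> v" for v
    unfolding \<phi>1_def bd_add bd_scale by (simp add: \<theta>' del: Un_insert_right)
  obtain \<psi>1 :: "'e \<Rightarrow> int" where \<psi>1: "\<forall>a\<in>K - {e}. \<not> 3 dvd \<psi>1 a"
    "\<forall>v. 3 dvd bd s d K \<psi>1 v - bd s d K \<phi>1 v"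
    using tricon_flexible [OF assms(1-3)] unfolding flexible_def by blast
  define \<phi>2 where "\<phi>2 = (\<lambda>a. if a \<in> K then \<psi>1 a else \<phi>1 a)"
  have \<phi>2: "3 dvd bd s d ?H \<phi>2 v - bd s d ?H \<phi> v" for v
  proof -
    have "bd s d K \<phi>2 v = bd s d K \<psi>1 v" by (intro bd_cong) (auto simp: \<phi>2_def)
    moreover have "bd s d {f, g} \<phi>2 v = bd s d {f, g} \<phi>1 v"
      using assms(4,5) by (intro bd_cong) (auto simp: \<phi>2_def)
    ultimately have "bd s d ?H \<phi>2 v - bd s d ?H \<phi>1 v = bd s d K \<psi>1 v - bd s d K \<phi>1 v"
      unfolding split by simp
    then show ?thesis using \<psi>1(2) \<phi>1 by simp
  qed
  \<comment> \<open>Only \<open>e\<close> and \<open>f\<close> have to be avoided; \<open>g\<close>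
    follows \<open>f\<close>.\<close>
  obtain x where x: "\<not> 3 dvd \<phi>2 e + x * \<kappa> e" "\<not> 3 dvd \<phi>2 f + x * \<kappa> f"
    using avoid_two_residues pm by (metis insert_iff)
  define \<psi> where "\<psi> = (\<lambda>a. \<phi>2 a + x * \<kappa> a)"
  have "\<phi>2 f = \<kappa> f * \<kappa> g * \<phi>2 g" using \<phi>1fg assms(4,5) by (simp add: \<phi>2_def)
  then have "\<psi> g = \<psi> f \<or> \<psi> g = - \<psi> f" using pm by (auto simp: \<psi>_def)
  moreover have "\<not> 3 dvd \<psi> f" using x(2) by (simp add: \<psi>_def)
  ultimately have g: "\<not> 3 dvd \<psi> g" by auto
  have "\<not> 3 dvd \<psi> a" if "a \<in> ?H" for a
  proof -
    consider "a = e" | "a = f" | "a = g" | "a \<notin> {e, f, g}" by blast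
    then show ?thesis
    proof cases
      case 4
      then have "\<psi> a = \<psi>1 a" using that \<kappa> by (auto simp: \<psi>_def \<phi>2_def circuit_def)
      then show ?thesis using 4 that \<psi>1(1) by auto
    qed (use x g in \<open>auto simp: \<psi>_def\<close>)
  qed
  moreover have "3 dvd bd s d ?H \<psi> v - bd s d ?H \<phi> v" for v
  proof -
    have "bd s d ?H \<kappa> v = 0" using assms(3) by (intro circuit_bd [OF \<kappa> _ fin]) auto
    then have "bd s d ?H \<psi> v = bd s d ?H \<phi>2 v" unfolding \<psi>_def bd_add bd_scale by simp
    then show ?thesis using \<phi>2 by simp
  qed
  ultimately show ?thesis by blast
qed

text \<open>A maximal 2-tree \<open>K\<close> is not all of \<open>E\<close>, as it would have a
  flow. At a triangle leaving it only one edge \<open>f\<close> is new: two new edges would enlarge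
  \<open>K\<close> or, if their common end is old, be excluded by \<open>closed_ear_realise\<close>.
  The link of the hub joins the other two edges inside \<open>K\<close>, and \<open>f\<close> closes
  the rim.\<close>

lemma wheel_exists:
  assumes fin: "finite E" and tc: "tricon E" and nf: "\<not> z3flow s d E" and ns: "\<nexists>e. E = {e}"
  obtains n h v sp rm where "wheel n h v sp rm" "wedges n sp rm \<subseteq> E"
proof -
  have "E \<noteq> {}" using nf by (auto simp: z3flow_def)
  then obtain c where "c \<in> E" by blast
  let ?F = "{K. K \<subseteq> E \<and> twotree K}"
  have "{c} \<in> ?F" using \<open>c \<in> E\<close> by (simp add: single)
  moreover have "finite ?F" using fin by simp
  ultimately obtain K where K: "K \<subseteq> E" "twotree K"
    and max: "\<And>K'. K' \<subseteq> E \<Longrightarrow> twotree K' \<Longrightarrow> K \<subseteq> K' \<Longrightarrow> K = K'"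
    by (metis (no_types, lifting) empty_iff finite_has_maximal mem_Collect_eq)
  have "K \<noteq> E" using twotree_z3flow [OF K(2)] nf ns by blast
  moreover have "K \<noteq> {}" using K(2) by (induction rule: twotree.induct) auto
  ultimately obtain e f where ef: "(e, f) \<in> trel E" "e \<in> K" "f \<in> E - K"
    using tricon_cross [OF tc K(1)] by blast
  have "ends e \<noteq> ends f" using no_parallel_edges [OF fin tc nf] ef K(1) by blast
  then obtain g where g: "g \<in> E" "triangle e f g" using ef(1) by (auto simp: trel_def)
  obtain x y z where xyz: "ends e = {x, y}" "ends f = {y, z}" "ends g = {x, z}"
    "x \<noteq> y" "y \<noteq> z" "x \<noteq> z" using g(2) by (auto simp: triangle_def)
  have "g \<in> K"
  proof (rule ccontr)
    assume "g \<notin> K"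
    show False
    proof (cases "\<exists>k\<in>K. z \<in> ends k")
      case True
      then obtain k where k: "k \<in> K" "z \<in> ends k" by blast
      have H: "K \<union> {f, g} \<subseteq> E" using K ef g by auto
      obtain \<phi> :: "'e \<Rightarrow> int" where \<phi>: "\<forall>a\<in>E - {e}. \<not> 3 dvd \<phi> a" "\<forall>v. 3 dvd bd s d E \<phi> v"
        using tricon_near_flow [OF fin tc] ef K(1) by blast
      obtain \<psi> :: "'e \<Rightarrow> int" where "\<forall>a\<in>K \<union> {f, g}. \<not> 3 dvd \<psi> a"
        "\<forall>v. 3 dvd bd s d (K \<union> {f, g}) \<psi> v - bd s d (K \<union> {f, g}) \<phi> v"
        using closed_ear_realise [of K e f g z k \<phi>] twotree_finite twotree_tricon K ef g k xyz
          \<open>g \<notin> K\<close> by blast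
      then have "z3flow s d E"
        using z3flow_replace [OF fin H _ \<phi>(2)] \<phi>(1) ef(2) by blast
      then show False using nf by blast
    next
      case False
      then have "twotree (K \<union> {f, g})" using K(2) ef(2) g(2) xyz by (intro grow) auto
      then have "K = K \<union> {f, g}" using K ef g by (intro max) auto
      then show False using ef by blast
    qed
  qed
  then have "(e, g) \<in> (lrel K x)\<^sup>*"
    using twotree_link_connected [OF K(2) ef(2)] xyz by auto
  then obtain m c where c: "c 0 = e" "c m = g" "\<And>i. i < m \<Longrightarrow> (c i, c (Suc i)) \<in> lrel K x"
    "inj_on c {..m::nat}" using rtrancl_simple_path by metis
  \<comment> \<open>If \<open>e\<close> and \<open>g\<close> were adjacent in the link,
    \<open>K\<close> would contain an edge parallel to \<open>f\<close>. Hence the rim length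
    \<open>Suc m\<close> is at least 3.\<close>
  have m: "m \<ge> 2"
  proof (rule ccontr)
    assume "\<not> m \<ge> 2"
    then have "m = 0 \<or> m = 1" by auto
    moreover have "m \<noteq> 0" using c g(2) triangle_distinct by metis
    ultimately have "(e, g) \<in> lrel K x" using c(1,2) c(3) [of 0] by auto
    then obtain r where "r \<in> K" "triangle e g r" by (auto simp: lrel_def)
    then have "ends r = ends f" using triangle_third(1) [of e g r x y z] xyz by simp
    then show False using no_parallel_edges [OF fin tc nf, of r f] \<open>r \<in> K\<close> ef K(1) by blast
  qed
  have cK: "c i \<in> K \<and> x \<in> ends (c i)" if "i \<le> m" for i
  proof (cases "i = m")
    case False
    then show ?thesis using c(3) [of i] that by (auto simp: lrel_def)
  qed (use c \<open>g \<in> K\<close> xyz in auto)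
  have "\<exists>u. ends (c i) = {x, u}" if "i \<le> m" for i
    using cK [OF that] unfolding ends_def by blast
  then obtain v where v: "\<And>i. i \<le> m \<Longrightarrow> ends (c i) = {x, v i}" by metis
  have "\<exists>r\<in>K. triangle (c i) (c (Suc i)) r" if "i < m" for i
    using c(3) [OF that] by (auto simp: lrel_def)
  then obtain r where r: "\<And>i. i < m \<Longrightarrow> r i \<in> K \<and> triangle (c i) (c (Suc i)) (r i)" by metis
  \<comment> \<open>The index \<open>m\<close>, one past the triangles of the fan, is taken by
    \<open>f\<close>.\<close>
  define rm where "rm = (\<lambda>i. if i < m then r i else f)"
  have v0: "v 0 = y" and vm: "v m = z"
    using v [of 0] v [of m] c(1,2) xyz by (auto simp: doubleton_eq_iff)
  have "ends (rm i) = {v i, v (Suc i mod Suc m)}" if "i < Suc m" for i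
  proof (cases "i = m")
    case True
    then show ?thesis using v0 vm xyz by (auto simp: rm_def)
  next
    case False
    then have "i < m" using that by simp
    then show ?thesis
      using triangle_third(1) [of "c i" "c (Suc i)" "r i" x] r v [of i] v [of "Suc i"]
      by (simp add: rm_def)
  qed
  moreover have "inj_on v {..<Suc m}"
  proof (rule inj_onI)
    fix i j assume ij: "i \<in> {..<Suc m}" "j \<in> {..<Suc m}" "v i = v j"
    then have "c i = c j" using no_parallel_edges [OF fin tc nf, of "c i" "c j"] cK v K(1)
      by (metis lessThan_iff less_Suc_eq_le subsetD)
    then show "i = j" using c(4) ij by (auto simp: inj_on_def)
  qed
  moreover have "x \<notin> v ` {..<Suc m}" using v ends_neq by (force simp: less_Suc_eq_le)
  ultimately have "wheel (Suc m) x v c rm"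
    using m v by (auto simp: wheel_def less_Suc_eq_le)
  moreover have "wedges (Suc m) c rm \<subseteq> E"
    using cK r ef K(1) by (auto simp: wedges_def rm_def less_Suc_eq_le)
  ultimately show thesis using that by blast
qed

end

section \<open>Splitting at an edge of a wheel\<close>

context loopless
begin

lemma wheel_nontrivial: "wheel n h v sp rm \<Longrightarrow> \<nexists>e. wedges n sp rm = {e}"
proof
  assume W: "wheel n h v sp rm" and "\<exists>e. wedges n sp rm = {e}"
  then obtain e where e: "wedges n sp rm = {e}" by blast
  have "n \<ge> 3" using W by (simp add: wheel_def)
  then have "sp 0 \<in> sp ` {..<n}" "rm 0 \<in> rm ` {..<n}" by simp_all
  then show False using e wheel_inj(3) [OF W] unfolding wedges_def by (metis Un_iff disjoint_iff singletonD)
qed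

lemma wheel_tricon:
  assumes W: "wheel n h v sp rm"
  shows "tricon (wedges n sp rm)"
proof (rule triconI)
  let ?W = "wedges n sp rm"
  have n: "n \<ge> 3" using W by (simp add: wheel_def)
  have tri: "triangle (sp i) (rm i) (sp (Suc i mod n))" if "i < n" for i
  proof -
    have nx: "Suc i mod n < n" using n by simp
    have i: "ends (sp i) = {h, v i}" "ends (rm i) = {v i, v (Suc i mod n)}"
      "ends (sp (Suc i mod n)) = {h, v (Suc i mod n)}"
      using W that nx by (auto simp: wheel_def)
    then show ?thesis using ends_neq [OF i(1)] ends_neq [OF i(2)] ends_neq [OF i(3)]
      by (intro triangleI [of h "v i" "v (Suc i mod n)"])
  qed
  have mem: "sp i \<in> ?W" "rm i \<in> ?W" if "i < n" for i using that by (auto simp: wedges_def)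
  have sp: "(sp i, sp 0) \<in> (trel ?W)\<^sup>*" if "i < n" for i
    using that
  proof (induction i)
    case (Suc i)
    then have "triangle (sp i) (rm i) (sp (Suc i))"
      using tri [of i] by simp
    then have "triangle (sp (Suc i)) (sp i) (rm i)" by (rule triangle_perms(3))
    then have "(sp (Suc i), sp i) \<in> trel ?W" using mem Suc.prems by (auto intro: triangle_trel)
    then show ?case using Suc by (simp add: converse_rtrancl_into_rtrancl)
  qed simp
  have "(rm i, sp i) \<in> trel ?W" if "i < n" for i
    using triangle_perms(1) [OF tri [OF that]] mem that n by (intro triangle_trel) auto
  then show "(e, sp 0) \<in> (trel ?W)\<^sup>*" if "e \<in> ?W" for e
    using that sp by (auto simp: wedges_def intro: converse_rtrancl_into_rtrancl)
qed

lemma bd_delete: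
  assumes "finite W" "e \<in> W"
  shows "bd s d W f x = f e * (of_bool (s e = x) - of_bool (d e = x)) + bd s d (W - {e}) f x"
  using bd_insert [of "W - {e}" e s d f x] assms by (simp add: insert_absorb)

lemma of_bool_ends_diff:
  "x \<in> ends e \<Longrightarrow> (of_bool (s e = x) - of_bool (d e = x) :: int) \<in> {1, -1}"
  "x \<notin> ends e \<Longrightarrow> (of_bool (s e = x) - of_bool (d e = x) :: int) = 0"
  using src_neq_dst [of e] by (auto simp: ends_def)

text \<open>Otherwise \<open>wheel_realise\<close> would match the boundary with nonzero values on
  the wheel, and \<open>z3flow_replace\<close> would produce a flow on \<open>E\<close>.\<close>

lemma rest_boundary:
  fixes \<phi> :: "'e \<Rightarrow> int"
  assumes "finite E" "\<not> z3flow s d E" "wheel n h v sp rm" "wedges n sp rm \<subseteq> E"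
    and "\<forall>a\<in>E - wedges n sp rm. \<not> 3 dvd \<phi> a" "\<forall>x. 3 dvd bd s d E \<phi> x"
  shows "odd n" "3 dvd bd s d (wedges n sp rm) \<phi> x"
proof -
  have "\<not> (even n \<or> (\<exists>x. \<not> 3 dvd bd s d (wedges n sp rm) \<phi> x))"
  proof
    assume "even n \<or> (\<exists>x. \<not> 3 dvd bd s d (wedges n sp rm) \<phi> x)"
    from wheel_realise [OF assms(3) this] show False
      using z3flow_replace [OF assms(1,4,5,6)] assms(2) by blast
  qed
  then show "odd n" "3 dvd bd s d (wedges n sp rm) \<phi> x" by auto
qed

text \<open>Otherwise changing the sign of the value on \<open>r\<close> would give the rest of the graph a
  nonzero boundary.\<close>

lemma wheel_induced:
  assumes fin: "finite E" and tc: "tricon E" and nf: "\<not> z3flow s d E"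
    and W: "wheel n h v sp rm" "wedges n sp rm \<subseteq> E"
    and r: "r \<in> E - wedges n sp rm" "ends r \<subseteq> (\<Union>a\<in>wedges n sp rm. ends a)"
  shows False
proof -
  let ?W = "wedges n sp rm"
  obtain c where c: "c \<in> ?W" using W(1) by (fastforce simp: wedges_def wheel_def)
  obtain \<phi> :: "'e \<Rightarrow> int" where \<phi>: "\<forall>a\<in>E - {c}. \<not> 3 dvd \<phi> a" "\<forall>v. 3 dvd bd s d E \<phi> v"
    using tricon_near_flow [OF fin tc] c W(2) by blast
  obtain x y where xy: "ends r = {x, y}" by (auto simp: ends_def)
  then obtain a b where "a \<in> ?W" "x \<in> ends a" "b \<in> ?W" "y \<in> ends b" using r(2) by auto
  then obtain \<theta> :: "'e \<Rightarrow> int" where \<theta>: "\<forall>v. bd s d ?W \<theta> v = of_bool (x = v) - of_bool (y = v)"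
    using tricon_path [OF wheel_tricon [OF W(1)] finite_wedges] by blast
  \<comment> \<open>The sign change on \<open>r\<close> amounts to adding
    \<open>- 2 * \<phi> r\<close> there; sending \<open>k\<close> units through the wheel between
    the ends of \<open>r\<close> compensates for it.\<close>
  define k where "k = 2 * \<phi> r * dir r x"
  define \<theta>' where "\<theta>' = (\<lambda>a. if a \<in> ?W then k * \<theta> a else if a = r then - 2 * \<phi> r else 0)"
  have \<theta>W: "bd s d ?W \<theta>' v = k * (of_bool (x = v) - of_bool (y = v))" for v
  proof -
    have "bd s d ?W \<theta>' v = bd s d ?W (\<lambda>a. k * \<theta> a) v" by (intro bd_cong) (auto simp: \<theta>'_def)
    then show ?thesis using \<theta> by (simp add: bd_scale)
  qed
  have \<theta>E: "bd s d E \<theta>' v = 0" for v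
  proof -
    have "bd s d (E - ?W) \<theta>' v = bd s d {r} \<theta>' v"
      using fin r by (intro bd_supp) (auto simp: \<theta>'_def)
    also have "\<dots> = - 2 * \<phi> r * (of_bool (s r = v) - of_bool (d r = v))"
      using r by (simp add: bd_def \<theta>'_def)
    also have "of_bool (s r = v) - of_bool (d r = v) = (dir r x * (of_bool (x = v) - of_bool (y = v)) :: int)"
      unfolding dir_bd [OF xy, symmetric] by (simp add: dir_def)
    finally show ?thesis
      using bd_split [OF fin W(2), of s d \<theta>' v] by (simp add: \<theta>W k_def)
  qed
  define \<psi> where "\<psi> = (\<lambda>a. \<phi> a + \<theta>' a)"
  have "\<not> 3 dvd \<psi> a" if "a \<in> E - ?W" for a
  proof -
    have "\<not> 3 dvd \<phi> a" using \<phi>(1) that c by auto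
    then show ?thesis using that by (auto simp: \<psi>_def \<theta>'_def)
  qed
  moreover have "bd s d E \<psi> v = bd s d E \<phi> v" for v by (simp add: \<psi>_def bd_add \<theta>E)
  ultimately have "3 dvd bd s d ?W \<psi> x"
    using \<phi>(2) by (intro rest_boundary(2) [OF fin nf W]) auto
  moreover have "3 dvd bd s d ?W \<phi> x"
    using \<phi> c by (intro rest_boundary(2) [OF fin nf W]) auto
  ultimately have "3 dvd bd s d ?W \<theta>' x" unfolding \<psi>_def bd_add by (simp add: dvd_add_right_iff)
  then have "3 dvd k" using ends_neq [OF xy] by (simp add: \<theta>W)
  moreover have "\<not> 3 dvd \<phi> r" using \<phi>(1) r(1) c by auto
  ultimately show False unfolding k_def dir_def by (simp split: if_splits, presburger+)
qed

text \<open>While the missing edge is moved by \<open>rotate_missing_edge\<close> within the class \<open>C\<close> of edges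
  outside the wheel, the flow on the wheel changes only on \<open>e\<close>; moving it back into the wheel
  through an edge other than \<open>e\<close> would contradict \<open>rest_boundary\<close>.\<close>

lemma wheel_split:
  assumes fin: "finite E" and tc: "tricon E" and nf: "\<not> z3flow s d E"
    and W: "wheel n h v sp rm" "wedges n sp rm \<subseteq> E" "wedges n sp rm \<noteq> E"
  obtains e C where "e \<in> wedges n sp rm" "C \<subseteq> E - wedges n sp rm" "C \<noteq> {}"
    "tricon (insert e C)" "tricon (E - C)"
proof -
  define V where "V = wedges n sp rm"
  have VE: "V \<subseteq> E" "V \<noteq> E" "finite V" using W fin by (auto simp: V_def)
  note rest = rest_boundary(2) [OF fin nf W(1,2), folded V_def]
  note par = no_parallel_edges [OF fin tc nf]
  obtain c where "c \<in> V" using W(1) by (fastforce simp: wedges_def wheel_def V_def)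
  have induced: False if "triangle r a b" "r \<in> E - V" "a \<in> V" "b \<in> V" for r a b
  proof -
    have "ends r \<subseteq> ends a \<union> ends b" using that(1) by (auto simp: triangle_def)
    then show False using wheel_induced [OF fin tc nf W(1,2), of r] that by (auto simp: V_def)
  qed
  obtain e f where ef: "(e, f) \<in> trel E" "e \<in> V" "f \<in> E - V"
    using tricon_cross [OF tc VE(1) \<open>c \<in> V\<close> VE(2)] by blast
  then obtain g where g: "g \<in> E" "triangle e f g"
    using par [of e f] VE(1) by (auto simp: trel_def)
  have gV: "g \<notin> V" using induced [of f e g] ef g triangle_perms by blast
  \<comment> \<open>Moves between edges off the wheel; the third edge of the triangle may belong to
    the wheel.\<close>
  define R where "R = {(a, b). a \<in> E - V \<and> b \<in> E - V \<and> (\<exists>c\<in>E. triangle a b c)}"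
  define C where "C = R\<^sup>* `` {f}"
  have CE: "C \<subseteq> E - V"
  proof
    fix a assume "a \<in> C"
    then have "(f, a) \<in> R\<^sup>*" by (simp add: C_def)
    then show "a \<in> E - V" using ef(3) by (induction rule: rtrancl_induct) (auto simp: R_def)
  qed
  \<comment> \<open>Invariant of the moves: the flow on \<open>V - {e}\<close> stays balanced mod 3,
    which holds as long as a move touches the wheel at most in \<open>e\<close>.\<close>
  define B where "B = (\<lambda>g. \<exists>\<phi>::'e \<Rightarrow> int. (\<forall>a\<in>E - {g}. \<not> 3 dvd \<phi> a) \<and> (\<forall>x. 3 dvd bd s d E \<phi> x) \<and>
    (\<forall>x. 3 dvd bd s d (V - {e}) \<phi> x))"
  have key: "b = e" if k: "B a" "triangle a b c" "a \<in> E - V" "b \<in> V" "c \<in> E" for a b c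
  proof (rule ccontr)
    assume "b \<noteq> e"
    have tri: "{a, b, c} \<subseteq> E" using k VE by auto
    have "c \<notin> V" using induced [of a b c] k by blast
    obtain \<phi> :: "'e \<Rightarrow> int" where \<phi>: "\<forall>x\<in>E - {a}. \<not> 3 dvd \<phi> x" "\<forall>x. 3 dvd bd s d E \<phi> x"
      "\<forall>x. 3 dvd bd s d (V - {e}) \<phi> x" using k(1) unfolding B_def by (elim exE conjE)
    obtain \<psi> :: "'e \<Rightarrow> int" where \<psi>: "\<forall>x\<in>E - {b}. \<not> 3 dvd \<psi> x" "\<forall>x. 3 dvd bd s d E \<psi> x"
      "\<And>x. x \<notin> {a, b, c} \<Longrightarrow> \<psi> x = \<phi> x"
      using rotate_missing_edge [OF fin nf \<phi>(1,2) k(2) tri] by metis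
    have "ends e \<noteq> ends b" using par [of e b] ef k \<open>b \<noteq> e\<close> VE by auto
    then have "\<not> ends e \<subseteq> ends b"
      using src_neq_dst [of e] src_neq_dst [of b] by (auto simp: ends_def doubleton_eq_iff)
    then obtain x where x: "x \<in> ends e" "x \<notin> ends b" by blast
    \<comment> \<open>The zero now lies in the wheel, so \<open>V\<close> is balanced. At
      \<open>x\<close>, an end of \<open>e\<close> but not of \<open>b\<close>, the edges of
      \<open>V - {e}\<close> are balanced as well, which forces \<open>\<psi> e\<close> to be 0 mod
      3.\<close>
    have "3 dvd bd s d V \<psi> x" using \<psi> k(4) by (intro rest) auto
    then have "3 dvd \<psi> e * (of_bool (s e = x) - of_bool (d e = x)) + bd s d (V - {e}) \<psi> x"
      using bd_delete [OF VE(3) ef(2)] by metis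
    moreover have "bd s d (V - {e}) \<psi> x = bd s d (V - {e}) \<phi> x"
    proof -
      have "bd s d (V - {e} - {b}) \<psi> x = bd s d (V - {e} - {b}) \<phi> x"
        using \<open>c \<notin> V\<close> k(3) by (intro bd_cong \<psi>(3)) auto
      then show ?thesis
        using bd_delete [of "V - {e}" b \<psi> x] bd_delete [of "V - {e}" b \<phi> x] VE(3) k \<open>b \<noteq> e\<close>
          of_bool_ends_diff(2) [OF x(2)] by simp
    qed
    ultimately have "3 dvd \<psi> e * (of_bool (s e = x) - of_bool (d e = x))"
      using \<phi>(3) by (metis dvd_add_left_iff)
    then have "3 dvd \<psi> e" using of_bool_ends_diff(1) [OF x(1)] by auto
    then show False using \<psi>(1) ef VE \<open>b \<noteq> e\<close> by blast
  qed
  have BC: "B a" if "a \<in> C" for a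
  proof -
    have rot: "B b" if \<phi>: "\<forall>x\<in>E - {a}. \<not> 3 dvd \<phi> x" "\<forall>x. 3 dvd bd s d E \<phi> x"
      "\<forall>x. 3 dvd bd s d (V - {e}) \<phi> x"
      and tri: "triangle a b c" "{a, b, c} \<subseteq> E" "{a, b, c} \<inter> V \<subseteq> {e}" for a b c and \<phi> :: "'e \<Rightarrow> int"
    proof -
      obtain \<psi> :: "'e \<Rightarrow> int" where \<psi>: "\<forall>x\<in>E - {b}. \<not> 3 dvd \<psi> x" "\<forall>x. 3 dvd bd s d E \<psi> x"
        "\<And>x. x \<notin> {a, b, c} \<Longrightarrow> \<psi> x = \<phi> x"
        using rotate_missing_edge [OF fin nf \<phi>(1,2) tri(1,2)] by metis
      have "bd s d (V - {e}) \<psi> x = bd s d (V - {e}) \<phi> x" for x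
        using tri(3) by (intro bd_cong \<psi>(3)) auto
      then show ?thesis unfolding B_def using \<psi>(1,2) \<phi>(3) by (intro exI [of _ \<psi>]) simp
    qed
    \<comment> \<open>With the zero at \<open>e\<close>, the balance of \<open>V\<close> is that of
      \<open>V - {e}\<close>; one move through the triangle with \<open>g\<close> brings it to
      \<open>f\<close>.\<close>
    obtain \<phi> :: "'e \<Rightarrow> int" where \<phi>: "\<forall>a\<in>E - {e}. \<not> 3 dvd \<phi> a" "\<forall>v. 3 dvd bd s d E \<phi> v"
      using tricon_near_flow [OF fin tc] ef VE by blast
    have "3 dvd \<phi> e" using \<phi> nf by (auto simp: z3flow_def)
    moreover have "3 dvd bd s d V \<phi> x" for x using \<phi> ef(2) by (intro rest) auto
    ultimately have "3 dvd bd s d (V - {e}) \<phi> x" for x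
      using bd_delete [OF VE(3) ef(2), of \<phi> x] by (metis dvd_add_right_iff dvd_mult2)
    then have Bf: "B f" using rot [OF \<phi> _ g(2)] ef g gV VE by blast
    have "(f, a) \<in> R\<^sup>*" using that by (simp add: C_def)
    then show "B a"
    proof (induction rule: rtrancl_induct)
      case base
      show ?case by (rule Bf)
    next
      case (step a b)
      then obtain c where c: "c \<in> E" "triangle a b c" "a \<in> E - V" "b \<in> E - V" by (auto simp: R_def)
      have "c = e" if "c \<in> V"
        using key [OF step.IH triangle_perms(2) [OF c(2)] c(3) that] c(4) by blast
      then have "{a, b, c} \<subseteq> E" "{a, b, c} \<inter> V \<subseteq> {e}" using c by auto
      moreover obtain \<phi> :: "'e \<Rightarrow> int" where "\<forall>x\<in>E - {a}. \<not> 3 dvd \<phi> x"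
        "\<forall>x. 3 dvd bd s d E \<phi> x" "\<forall>x. 3 dvd bd s d (V - {e}) \<phi> x"
        using step.IH unfolding B_def by (elim exE conjE)
      ultimately show ?case using rot [OF _ _ _ c(2)] by blast
    qed
  qed
  have CV: "b = e" if "a \<in> C" "b \<in> V" "c \<in> E" "triangle a b c" for a b c
    using key [OF BC] that CE by blast
  have CR: "b \<in> C" if "a \<in> C" "b \<in> E - V" "c \<in> E" "triangle a b c" for a b c
  proof -
    have "(a, b) \<in> R" using that CE by (auto simp: R_def)
    then show ?thesis using that(1) unfolding C_def by (auto intro: rtrancl_into_rtrancl)
  qed
  have fC: "f \<in> C" by (simp add: C_def)
  have gC: "g \<in> C" using CR [of f g e] fC g gV ef VE triangle_perms by blast
  have "tricon (insert e C)"
  proof (rule triconI [of _ f])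
    fix a assume a: "a \<in> insert e C"
    have "(f, a) \<in> (trel (insert e C))\<^sup>*" if "a \<in> C"
    proof -
      have "(f, a) \<in> R\<^sup>*" using that by (simp add: C_def)
      then show ?thesis
      proof (induction rule: rtrancl_induct)
        case (step a b)
        then have "a \<in> C" "b \<in> C" by (auto simp: C_def intro: rtrancl_into_rtrancl)
        obtain c where c: "c \<in> E" "triangle a b c" using step by (auto simp: R_def)
        have "c \<in> insert e C"
          using CV [of a c b] CR [of a c b] triangle_perms(2) [OF c(2)] \<open>a \<in> C\<close> \<open>b \<in> C\<close> CE c(1) by blast
        then have "(a, b) \<in> trel (insert e C)"
          using c(2) \<open>a \<in> C\<close> \<open>b \<in> C\<close> by (intro triangle_trel) auto
        then show ?case using step.IH by (rule rtrancl_into_rtrancl [rotated])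
      qed simp
    qed
    moreover have "(e, f) \<in> trel (insert e C)" using g(2) fC gC by (intro triangle_trel) auto
    ultimately show "(a, f) \<in> (trel (insert e C))\<^sup>*" using a trel_rtrancl_sym by blast
  qed
  moreover have "tricon (E - C)"
  proof (rule triconI [of _ e])
    fix a assume a: "a \<in> E - C"
    have "(e, a) \<in> (trel E)\<^sup>*" using tc a ef VE by (auto simp: tricon_def)
    then have "a \<notin> C \<longrightarrow> (e, a) \<in> (trel (E - C))\<^sup>*"
    proof (induction rule: rtrancl_induct)
      case (step a b)
      have ab: "a \<in> E" "b \<in> E" using step by (auto simp: trel_def)
      show ?case
      proof (cases "a = b")
        case True
        then show ?thesis using step.IH by simp
      next
        case False
        then obtain c where c: "c \<in> E" "triangle a b c"
          using step(2) par [of a b] by (auto simp: trel_def)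
        note perms = triangle_perms [OF c(2)] c
        show ?thesis
        proof (intro impI)
          assume "b \<notin> C"
          show "(e, b) \<in> (trel (E - C))\<^sup>*"
          proof (cases "a \<in> C")
            case True
            then have "b = e" using CR [of a b c] CV [of a b c] \<open>b \<notin> C\<close> perms ab by blast
            then show ?thesis by simp
          next
            case False
            have "c \<notin> C"
            proof
              assume "c \<in> C"
              then have "a = e" "b = e"
                using CR [of c a b] CV [of c a b] CR [of c b a] CV [of c b a] perms ab \<open>b \<notin> C\<close> False
                by blast+
              then show False using \<open>a \<noteq> b\<close> by simp
            qed
            then have "(a, b) \<in> trel (E - C)" using c ab False \<open>b \<notin> C\<close> by (intro triangle_trel) auto
            then show ?thesis using step.IH False by (meson rtrancl_into_rtrancl)
          qed
        qed
      qed
    qed simp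
    then show "(a, e) \<in> (trel (E - C))\<^sup>*" using a trel_rtrancl_sym by blast
  qed
  ultimately show thesis using that [of e C] ef CE fC by (auto simp: V_def)
qed

section \<open>Gluing flows along one shared edge, and the induction\<close>

lemma bd_extend_zero:
  assumes "finite E" "A \<subseteq> E"
  shows "bd s d E (\<lambda>a. if a \<in> A then f a else 0) v = bd s d A f v"
proof -
  have "bd s d E (\<lambda>a. if a \<in> A then f a else 0) v = bd s d A (\<lambda>a. if a \<in> A then f a else 0) v"
    using assms by (intro bd_supp) auto
  also have "\<dots> = bd s d A f v" by (intro bd_cong) auto
  finally show ?thesis .
qed

text \<open>The sum and the difference of the two flows cannot both vanish on \<open>e\<close> mod
  3, since twice a nonzero residue is nonzero.\<close>

lemma z3flow_glue:
  assumes "finite A" "finite B" "A \<inter> B = {e}" "z3flow s d A" "z3flow s d B"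
  shows "z3flow s d (A \<union> B)"
proof -
  obtain f g :: "'e \<Rightarrow> int" where f: "\<forall>a\<in>A. \<not> 3 dvd f a" "\<forall>v. 3 dvd bd s d A f v"
    and g: "\<forall>a\<in>B. \<not> 3 dvd g a" "\<forall>v. 3 dvd bd s d B g v"
    using assms(4,5) by (auto simp: z3flow_def)
  have "\<not> 3 dvd f e" "\<not> 3 dvd g e" using f(1) g(1) assms(3) by auto
  then have "\<not> 3 dvd f e + 1 * g e \<or> \<not> 3 dvd f e + (-1) * g e" by presburger
  then obtain t :: int where t: "t = 1 \<or> t = -1" "\<not> 3 dvd f e + t * g e" by blast
  define k where "k = (\<lambda>a. (if a \<in> A then f a else 0) + t * (if a \<in> B then g a else 0))"
  have "3 dvd bd s d (A \<union> B) k v" for v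
  proof -
    have "bd s d (A \<union> B) k v = bd s d A f v + t * bd s d B g v"
      unfolding k_def bd_add bd_scale using assms(1,2) by (simp add: bd_extend_zero)
    then show ?thesis using f(2) g(2) by simp
  qed
  moreover have "\<not> 3 dvd k a" if "a \<in> A \<union> B" for a
    using that f(1) g(1) t assms(3) by (cases "a = e"; cases "a \<in> A"; cases "a \<in> B") (auto simp: k_def)
  ultimately show ?thesis by (rule z3flowI [rotated])
qed

lemma sqrt3flow_Un:
  assumes "finite E" "A \<subseteq> E" "a \<in> A" "sqrt3flow A a" "unitflow s d (E - A)"
  shows "sqrt3flow E a"
proof -
  obtain f :: "'e \<Rightarrow> complex" where f: "\<forall>v. bd s d A f v = 0"
     "\<forall>b\<in>A - {a}. cmod (f b) = 1" "cmod (f a) = sqrt 3" using assms(4) by (auto simp: sqrt3flow_def)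
  obtain g :: "'e \<Rightarrow> complex" where g: "\<forall>b\<in>E - A. cmod (g b) = 1" "\<forall>v. bd s d (E - A) g v = 0"
    using assms(5) by (auto simp: unitflow_def)
  define k where "k = (\<lambda>b. (if b \<in> A then f b else 0) + (if b \<in> E - A then g b else 0))"
  have "bd s d E k v = 0" for v
    unfolding k_def bd_add using f(1) g(2) assms(1,2) by (subst (1 2) bd_extend_zero) auto
  moreover have "cmod (k b) = 1" if "b \<in> E - {a}" for b
    using f(2) g(1) that by (auto simp: k_def)
  moreover have "cmod (k a) = sqrt 3" using f(3) assms(3) by (simp add: k_def)
  ultimately show ?thesis unfolding sqrt3flow_def by blast
qed

text \<open>Rotating one of the flows, two vectors of length \<open>sqrt 3\<close> add up to a unit vector.\<close>

lemma unitflow_glue: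
  assumes "finite A" "finite B" "A \<inter> B = {e}" "sqrt3flow A e" "sqrt3flow B e"
  shows "unitflow s d (A \<union> B)"
proof -
  obtain f g :: "'e \<Rightarrow> complex" where f: "\<forall>v. bd s d A f v = 0"
     "\<forall>b\<in>A - {e}. cmod (f b) = 1" "cmod (f e) = sqrt 3"
     and g: "\<forall>v. bd s d B g v = 0"
     "\<forall>b\<in>B - {e}. cmod (g b) = 1" "cmod (g e) = sqrt 3"
    using assms(4,5) by (auto simp: sqrt3flow_def)
  \<comment> \<open>The unit vector with real part 5/6: the square of \<open>cmod (1 - w)\<close> is
    2 - 5/3 = 1/3, which scales length sqrt 3 down to 1.\<close>
  define w where "w = Complex (5/6) (sqrt 11 / 6)"
  have w: "cmod w = 1" "cmod (1 - w) = 1 / sqrt 3"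
    by (simp_all add: w_def cmod_def power_divide real_sqrt_divide)
  define t where "t = - (f e / g e) * w"
  have t: "cmod t = 1" using f(3) g(3) w by (simp add: t_def norm_mult norm_divide)
  have "g e \<noteq> 0" using g(3) by auto
  then have "f e + t * g e = f e * (1 - w)" by (simp add: t_def algebra_simps)
  then have fg: "cmod (f e + t * g e) = 1" using f(3) w(2) by (simp add: norm_mult)
  define k where "k = (\<lambda>a. (if a \<in> A then f a else 0) + t * (if a \<in> B then g a else 0))"
  have "bd s d (A \<union> B) k v = 0" for v
  proof -
    have "bd s d (A \<union> B) k v = bd s d A f v + t * bd s d B g v"
      unfolding k_def bd_add bd_scale using assms(1,2) by (simp add: bd_extend_zero)
    then show ?thesis using f(1) g(1) by simp
  qed
  moreover have "cmod (k a) = 1" if "a \<in> A \<union> B" for a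
  proof (cases "a = e")
    case True
    then have "a \<in> A" "a \<in> B" using assms(3) by auto
    then show ?thesis using True fg by (simp add: k_def)
  next
    case False
    then have "a \<notin> A \<or> a \<notin> B" using assms(3) by auto
    then show ?thesis using False that f(2) g(2) t by (auto simp: k_def norm_mult)
  qed
  ultimately show ?thesis unfolding unitflow_def by blast
qed

text \<open>The induction feeds on the first claim only: \<open>sqrt3flow\<close> at the shared edge
  of two parts gives a unit flow on their union, so the exceptional wheel is left only when nothing
  splits.\<close>

lemma no_z3flow_structure:
  assumes "finite E" "tricon E" "\<not> z3flow s d E" "\<nexists>e. E = {e}"
  shows "(\<forall>e\<in>E. sqrt3flow E e) \<and>
    (unitflow s d E \<or> (\<exists>n h v sp rm. odd n \<and> wheel n h v sp rm \<and> E = wedges n sp rm))"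
  using assms
proof (induction "card E" arbitrary: E rule: less_induct)
  case less
  note fin = less.prems(1) and tc = less.prems(2) and nf = less.prems(3)
  obtain n h v sp rm where W: "wheel n h v sp rm" "wedges n sp rm \<subseteq> E"
    using wheel_exists [OF less.prems] by blast
  obtain c where c: "c \<in> wedges n sp rm" using W(1) by (fastforce simp: wedges_def wheel_def)
  obtain \<phi> :: "'e \<Rightarrow> int" where \<phi>: "\<forall>a\<in>E - {c}. \<not> 3 dvd \<phi> a" "\<forall>v. 3 dvd bd s d E \<phi> v"
    using tricon_near_flow [OF fin tc] c W(2) by blast
  then have "odd n" using c by (intro rest_boundary(1) [OF fin nf W]) auto
  show ?case
  proof (cases "wedges n sp rm = E")
    case True
    then show ?thesis using wheel_sqrt3flow [OF W(1) \<open>odd n\<close>] W(1) \<open>odd n\<close> by blast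
  next
    case False
    obtain e C where e: "e \<in> wedges n sp rm" and C: "C \<subseteq> E - wedges n sp rm" "C \<noteq> {}"
      and tcs: "tricon (insert e C)" "tricon (E - C)"
      using wheel_split [OF fin tc nf W False] by blast
    define A where "A = insert e C"
    define B where "B = E - C"
    have AB: "A \<union> B = E" "A \<inter> B = {e}" "B - {e} = E - A" "A - {e} = E - B"
      using e C W(2) by (auto simp: A_def B_def)
    have finAB: "finite A" "finite B" "A \<subseteq> E" "B \<subseteq> E" using fin AB finite_subset by blast+
    have tAB: "tricon A" "tricon B" "e \<in> A" "e \<in> B" using tcs AB(2) by (auto simp: A_def B_def)
    have WB: "wedges n sp rm \<subseteq> B" using C W(2) by (auto simp: B_def)
    have nA: "\<nexists>a. A = {a}" using C e by (auto simp: A_def)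
    have nB: "\<nexists>a. B = {a}" using wheel_nontrivial [OF W(1)] WB c by (metis empty_iff subset_singletonD)
    have "A \<noteq> E" using nB AB(2) finAB(4) by (metis inf.absorb2)
    then have cards: "card A < card E" "card B < card E"
      using finAB fin C by (auto intro!: psubset_card_mono simp: B_def)
    \<comment> \<open>A flow on \<open>A\<close> would extend to \<open>E\<close>: by gluing if
      \<open>B\<close> has a flow, and otherwise by a flow on \<open>B - {e}\<close>.\<close>
    have nzA: "\<not> z3flow s d A"
    proof
      assume "z3flow s d A"
      then have "z3flow s d (A \<union> B)"
        using z3flow_glue [OF finAB(1,2) AB(2)] z3flow_delete [OF finAB(2) tAB(2,4)]
          z3flow_Un [of A "B - {e}"] finAB AB by (cases "z3flow s d B") auto
      then show False using nf AB by simp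
    qed
    have nzB: "\<not> z3flow s d B"
    proof
      assume "z3flow s d B"
      then have "z3flow s d (B \<union> (A - {e}))"
        using z3flow_delete [OF finAB(1) tAB(1,3) nzA] finAB AB by (intro z3flow_Un) auto
      moreover have "B \<union> (A - {e}) = E" using AB by blast
      ultimately show False using nf by simp
    qed
    have IH: "\<forall>a\<in>A. sqrt3flow A a" "\<forall>a\<in>B. sqrt3flow B a"
      using less.hyps [OF cards(1) finAB(1) tAB(1) nzA nA] less.hyps [OF cards(2) finAB(2) tAB(2) nzB nB]
      by blast+
    \<comment> \<open>What lies outside one part is the other part without \<open>e\<close>, which
      has a flow mod 3; each edge can therefore carry the length sqrt 3 within its own part.\<close>
    have "unitflow s d (E - B)" "unitflow s d (E - A)"
      using unitflow_if_z3flow z3flow_delete [OF finAB(1) tAB(1,3) nzA]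
        z3flow_delete [OF finAB(2) tAB(2,4) nzB] finAB AB by (metis finite_Diff)+
    then have "sqrt3flow E a" if "a \<in> E" for a
      using sqrt3flow_Un [OF fin, of A a] sqrt3flow_Un [OF fin, of B a] IH that AB finAB by blast
    moreover have "unitflow s d (A \<union> B)"
      using unitflow_glue [OF finAB(1,2) AB(2)] IH tAB by blast
    ultimately show ?thesis using AB by simp
  qed
qed

lemma tricon_unitflow:
  assumes "finite E" "tricon E" "\<nexists>e. E = {e}"
    and "\<nexists>n h v sp rm. odd n \<and> wheel n h v sp rm \<and> E = wedges n sp rm"
  shows "unitflow s d E"
  using no_z3flow_structure [OF assms(1,2) _ assms(3)] unitflow_if_z3flow [OF assms(1)] assms(4)
  by blast

end

section \<open>Graph classes\<close>

lemma gadj_sym: "(u, v) \<in> gadj G \<Longrightarrow> (v, u) \<in> gadj G"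
  by (auto simp: gadj_def insert_commute)

lemma gadj_verts:
  assumes "fin_loopless G" "(u, v) \<in> gadj G"
  shows "u \<in> gverts G" "v \<in> gverts G" "u \<noteq> v"
  using assms by (auto simp: gadj_def fin_loopless_def dest!: bspec)

text \<open>A single edge is triangularly connected but has no flow; being a bridge, it is excluded
  here.\<close>

lemma bridgeless_not_single:
  assumes "fin_loopless G" "bridgeless G"
  shows "\<nexists>e. gedges G = {e}"
proof
  assume "\<exists>e. gedges G = {e}"
  then obtain e where e: "gedges G = {e}" by blast
  have "gadj (delete_edge G e) = {}" using e by (auto simp: gadj_def delete_edge_def)
  moreover have "card (gends G e) = 2" using assms(1) e by (auto simp: fin_loopless_def)
  ultimately have "bridge G e" using e by (auto simp: bridge_def)
  then show False using assms(2) e by (auto simp: bridgeless_def)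
qed

lemma gdist_le_2:
  assumes "gdist H u v \<le> 2" "u \<noteq> v"
  shows "(u, v) \<in> gadj H \<or> (\<exists>m. (u, m) \<in> gadj H \<and> (m, v) \<in> gadj H)"
proof (rule ccontr)
  assume no: "\<not> ?thesis"
  have "3 \<le> enat n" if "(u, v) \<in> gadj H ^^ n" for n
  proof -
    have "n \<noteq> 0" using that assms(2) by (cases n) auto
    moreover have "n \<noteq> 1" "n \<noteq> 2" using that no by (auto simp: numeral_2_eq_2)
    ultimately have "3 \<le> n" by linarith
    then show ?thesis by (simp add: numeral_eq_enat)
  qed
  then have "3 \<le> gdist H u v" unfolding gdist_def by (intro INF_greatest) auto
  then have "(3::enat) \<le> 2" using assms(1) by (rule order_trans)
  then show False by simp
qed

lemma gdist_le:
  assumes "(u, v) \<in> gadj H ^^ n" "n \<le> 2"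
  shows "gdist H u v \<le> 2"
proof -
  have "gdist H u v \<le> enat n" unfolding gdist_def using assms(1) by (intro INF_lower) simp
  also have "\<dots> \<le> 2" using assms(2) by (simp add: numeral_eq_enat)
  finally show ?thesis .
qed

section \<open>Triangular connectivity of the three classes\<close>

locale oriented_graph = loopless s d for s d :: "'e \<Rightarrow> 'v" +
  fixes G :: "('v, 'e) ugraph"
  assumes fl: "fin_loopless G"
    and ends_gends: "e \<in> gedges G \<Longrightarrow> ends e = gends G e"
begin

text \<open>Formulated for neighbours of \<open>v\<close> rather than edges, with all parallel
  copies covered, so that walks among the neighbours can be used directly.\<close>

definition linked :: "'v \<Rightarrow> 'v \<Rightarrow> 'v \<Rightarrow> bool" where
  "linked v u w \<longleftrightarrow> (\<forall>a\<in>gedges G. \<forall>b\<in>gedges G. ends a = {v, u} \<longrightarrow> ends b = {v, w} \<longrightarrow>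
     (a, b) \<in> (trel (gedges G))\<^sup>*)"

lemma gadj_ends: "(u, v) \<in> gadj G \<longleftrightarrow> (\<exists>e\<in>gedges G. ends e = {u, v})"
  using ends_gends by (auto simp: gadj_def)

lemma linked_refl: "linked v u u"
  by (auto simp: linked_def trel_def)

text \<open>The adjacency premise provides a middle edge; without one both \<open>linked\<close>
  premises would be vacuous.\<close>

lemma linked_trans: "linked v u x \<Longrightarrow> linked v x w \<Longrightarrow> (v, x) \<in> gadj G \<Longrightarrow> linked v u w"
  unfolding linked_def gadj_ends by (meson rtrancl_trans)

lemma linked_sym: "linked v u w \<Longrightarrow> linked v w u"
  unfolding linked_def by (meson trel_rtrancl_sym)

lemma linked_triangle:
  assumes "(v, u) \<in> gadj G" "(v, w) \<in> gadj G" "(u, w) \<in> gadj G"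
  shows "linked v u w"
  unfolding linked_def
proof (intro ballI impI)
  fix a b assume ab: "a \<in> gedges G" "b \<in> gedges G" "ends a = {v, u}" "ends b = {v, w}"
  obtain c where c: "c \<in> gedges G" "ends c = {u, w}" using assms(3) by (auto simp: gadj_ends)
  have tri: "triangle a b c"
    using ab c assms [THEN gadj_verts(3) [OF fl]] by (intro triangleI [of u v w]) auto
  then show "(a, b) \<in> (trel (gedges G))\<^sup>*" using ab c triangle_trel [OF tri] by auto
qed

text \<open>By \<open>loc\<close> any two edges with a common end are connected by triangles, and a
  walk in \<open>G\<close> passes this on from edge to edge.\<close>

lemma tricon_graph:
  assumes con: "connected_ugraph G"
    and loc: "\<And>v u w. (v, u) \<in> gadj G \<Longrightarrow> (v, w) \<in> gadj G \<Longrightarrow> linked v u w"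
  shows "tricon (gedges G)"
  unfolding tricon_def
proof (intro ballI)
  have meet: "(a, b) \<in> (trel (gedges G))\<^sup>*"
    if ab: "a \<in> gedges G" "b \<in> gedges G" "v \<in> ends a" "v \<in> ends b" for a b v
  proof -
    have "\<exists>u. ends c = {x, u}" if "x \<in> ends c" for c x using that unfolding ends_def by blast
    then obtain u w where "ends a = {v, u}" "ends b = {v, w}" using ab by meson
    then show ?thesis using loc [of v u w] ab by (auto simp: gadj_ends linked_def)
  qed
  fix a b assume ab: "a \<in> gedges G" "b \<in> gedges G"
  then have "s a \<in> gverts G" "s b \<in> gverts G"
    using fl ends_gends [of a] ends_gends [of b] by (auto simp: fin_loopless_def ends_def)
  then have "(s a, s b) \<in> (gadj G)\<^sup>*" using con by (simp add: connected_ugraph_def)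
  then have "\<forall>b\<in>gedges G. s b = x \<or> d b = x \<longrightarrow> (a, b) \<in> (trel (gedges G))\<^sup>*" if "x = s b" for x
    unfolding that
  proof (induction rule: rtrancl_induct)
    case base
    then show ?case using meet [of a _ "s a"] ab by (auto simp: ends_def)
  next
    case (step y z)
    then obtain c where c: "c \<in> gedges G" "ends c = {y, z}" by (auto simp: gadj_ends)
    then have "s c = y \<or> d c = y" by (auto simp: ends_def doubleton_eq_iff)
    then have "(a, c) \<in> (trel (gedges G))\<^sup>*" using step.IH c by blast
    moreover have "(c, e) \<in> (trel (gedges G))\<^sup>*" if "e \<in> gedges G" "s e = z \<or> d e = z" for e
      using meet [of c e z] c that by (auto simp: ends_def)
    ultimately show ?case by (meson rtrancl_trans)
  qed
  then show "(a, b) \<in> (trel (gedges G))\<^sup>*" using ab by blast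
qed

text \<open>A walk in the neighbourhood of \<open>v\<close> is a fan of triangles at
  \<open>v\<close>.\<close>

lemma locally_connected_linked:
  assumes "locally_connected_ugraph G" "(v, u) \<in> gadj G" "(v, w) \<in> gadj G"
  shows "linked v u w"
proof -
  let ?N = "induced G (neighbors G v)"
  have "v \<in> gverts G" "u \<in> gverts G" "w \<in> gverts G" using gadj_verts [OF fl] assms by blast+
  then have "(u, w) \<in> (gadj ?N)\<^sup>*"
    using assms by (auto simp: locally_connected_ugraph_def connected_ugraph_def induced_def neighbors_def)
  then show ?thesis
  proof (induction rule: rtrancl_induct)
    case (step x y)
    then have "(v, x) \<in> gadj G" "(v, y) \<in> gadj G" "(x, y) \<in> gadj G"
      by (auto simp: gadj_def induced_def neighbors_def)
    then show ?case using step.IH linked_triangle linked_trans by blast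
  qed (rule linked_refl)
qed

text \<open>The neighbours of \<open>v\<close> in \<open>H\<close> are pairwise adjacent in the
  square, and every further neighbour of \<open>v\<close> is adjacent to one of them.\<close>

lemma square_linked:
  assumes H: "fin_loopless H" "is_square_of G H" and vu: "(v, u) \<in> gadj G" "(v, w) \<in> gadj G"
  shows "linked v u w"
proof -
  have sq: "(x, y) \<in> gadj G \<longleftrightarrow> x \<noteq> y \<and> gdist H x y \<le> 2" if "x \<in> gverts H" "y \<in> gverts H" for x y
    using H(2) that by (simp add: is_square_of_def)
  have gv: "gverts G = gverts H" using H(2) by (simp add: is_square_of_def)
  have one: "(x, y) \<in> gadj G" if "(x, y) \<in> gadj H" for x y
    using sq gadj_verts [OF H(1) that] gdist_le [of x y 1 H] that by simp
  have two: "(x, z) \<in> gadj G" if "(x, y) \<in> gadj H" "(y, z) \<in> gadj H" "x \<noteq> z" for x y z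
    using sq gadj_verts [OF H(1) that(1)] gadj_verts [OF H(1) that(2)] gdist_le [of x z 2 H] that
    by (auto simp: numeral_2_eq_2)
  have rep: "\<exists>m. (v, m) \<in> gadj H \<and> linked v u m" if vu: "(v, u) \<in> gadj G" for u
  proof -
    have "v \<in> gverts H" "u \<in> gverts H" "u \<noteq> v" using gadj_verts [OF fl vu] gv by auto
    then consider "(v, u) \<in> gadj H" | m where "(v, m) \<in> gadj H" "(m, u) \<in> gadj H"
      using gdist_le_2 [of H v u] sq vu by blast
    then show ?thesis
    proof cases
      case (2 m)
      have "linked v u m"
        by (rule linked_triangle [OF vu one [OF 2(1)] one [OF gadj_sym [OF 2(2)]]])
      then show ?thesis using 2(1) by blast
    next
      case 1
      then show ?thesis using linked_refl by blast
    qed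
  qed
  obtain m m' where m: "(v, m) \<in> gadj H" "linked v u m" "(v, m') \<in> gadj H" "linked v w m'"
    using rep vu by meson
  have "linked v m m'"
  proof (cases "m = m'")
    case False
    then show ?thesis
      by (intro linked_triangle one [OF m(1)] one [OF m(3)] two [OF gadj_sym [OF m(1)] m(3)])
  qed (simp add: linked_refl)
  then have "linked v u m'" using m(2) one [OF m(1)] linked_trans by blast
  then show ?thesis using linked_sym [OF m(4)] one [OF m(3)] linked_trans by blast
qed

text \<open>Together with \<open>v\<close> a path of length at least 2 forms a cycle. A chord at
  \<open>v\<close> splits the path into two shorter ones, any other chord is a shortcut; both cases
  are settled by induction on the length.\<close>

lemma chordal_linked_path:
  assumes ch: "chordal G"
    and "(v, f 0) \<in> gadj G" "(v, f n) \<in> gadj G" "\<And>i. i < n \<Longrightarrow> (f i, f (Suc i)) \<in> gadj G"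
    and "inj_on f {..n}" "v \<notin> f ` {..n::nat}"
  shows "linked v (f 0) (f n)"
  using assms(2-)
proof (induction n arbitrary: f rule: less_induct)
  case (less n)
  note ends = less.prems(1,2) and adj = less.prems(3)
  consider "n = 0" | "n = 1" | "n \<ge> 2" by linarith
  then show ?case
  proof cases
    case 1
    then show ?thesis by (simp add: linked_refl)
  next
    case 2
    then show ?thesis using ends adj [of 0] by (simp add: linked_triangle)
  next
    case 3
    define c where "c = v # map f [0..<Suc n]"
    have len: "length c = n + 2" by (simp add: c_def)
    have c0: "c ! 0 = v" by (simp add: c_def)
    have cS: "c ! Suc i = f i" if "i \<le> n" for i
      using that by (simp add: c_def del: upt_Suc)
    have "set [0..<Suc n] = {..n}" by auto
    then have "distinct c"
      using less.prems(4,5) by (simp add: c_def distinct_map del: upt_Suc)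
    moreover have "(c ! i, c ! (Suc i mod length c)) \<in> gadj G" if "i < length c" for i
    proof (cases i)
      case 0
      then show ?thesis using ends(1) c0 cS [of 0] by (simp add: len)
    next
      case (Suc j)
      show ?thesis
      proof (cases "j = n")
        case True
        then show ?thesis using Suc ends(2) c0 cS [of n] gadj_sym by (simp add: len)
      next
        case False
        then have "j < n" using Suc that len by simp
        then show ?thesis using Suc adj [of j] cS [of j] cS [of "Suc j"] by (simp add: len)
      qed
    qed
    ultimately have "has_chord G c"
      using ch 3 len by (simp add: chordal_def ucycle_def)
    then obtain i j where ij: "i < n + 2" "j < n + 2" "i \<noteq> j" "j \<noteq> Suc i mod (n + 2)"
      "i \<noteq> Suc j mod (n + 2)" "(c ! i, c ! j) \<in> gadj G"
      unfolding has_chord_def len by blast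
    have sub: "\<exists>i j. i < j \<and> j < n + 2 \<and> j \<noteq> Suc i \<and> (i = 0 \<longrightarrow> j \<noteq> Suc n) \<and> (c ! i, c ! j) \<in> gadj G"
    proof (cases "i < j")
      case True
      then have "j \<noteq> Suc i" "i = 0 \<longrightarrow> j \<noteq> Suc n" using ij by auto
      then show ?thesis using ij True by (intro exI [of _ i] exI [of _ j]) simp
    next
      case False
      then have "i \<noteq> Suc j" "j = 0 \<longrightarrow> i \<noteq> Suc n" "j < i" using ij by auto
      then show ?thesis using ij gadj_sym [OF ij(6)] by (intro exI [of _ j] exI [of _ i]) simp
    qed
    then obtain i j where ij: "i < j" "j < n + 2" "j \<noteq> Suc i" "i = 0 \<longrightarrow> j \<noteq> Suc n"
      "(c ! i, c ! j) \<in> gadj G" by blast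
    \<comment> \<open>Positions in \<open>c\<close> are one ahead of the indices of
      \<open>f\<close>, because \<open>v\<close> comes first.\<close>
    define b where "b = j - 1"
    have b: "b \<le> n" "j = Suc b" using ij by (auto simp: b_def)
    show ?thesis
    proof (cases i)
      case 0
      have k: "b < n" "b > 0" "(v, f b) \<in> gadj G" using ij b 0 c0 cS [of b] by auto
      have "linked v (f 0) (f b)"
      proof (rule less.IH)
        show "inj_on f {..b}" using less.prems(4) k(1) by (auto intro: inj_on_subset)
        show "v \<notin> f ` {..b}" using less.prems(5) k(1) by auto
      qed (use ends k adj in auto)
      moreover have "linked v (f (0 + b)) (f ((n - b) + b))"
      proof (rule less.IH [of "n - b" "\<lambda>x. f (x + b)"])
        show "inj_on (\<lambda>x. f (x + b)) {..n - b}"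
        proof (rule inj_onI)
          fix x y assume "x \<in> {..n - b}" "y \<in> {..n - b}" "f (x + b) = f (y + b)"
          then show "x = y" using inj_onD [OF less.prems(4), of "x + b" "y + b"] k by auto
        qed
        show "v \<notin> (\<lambda>x. f (x + b)) ` {..n - b}" using less.prems(5) k by auto
      qed (use ends k adj in auto)
      ultimately show ?thesis using linked_trans k by simp
    next
      case (Suc a)
      \<comment> \<open>The number of path vertices skipped by the chord from \<open>f a\<close> to
        \<open>f b\<close>.\<close>
      define t where "t = b - a - 1"
      have t: "t \<ge> 1" "a + t < n" "b = Suc a + t" using ij b Suc by (auto simp: t_def)
      define g where "g = (\<lambda>x. if x \<le> a then f x else f (x + t))"
      have g0: "g 0 = f 0" by (simp add: g_def)
      have gn: "g (n - t) = f n" using t by (auto simp: g_def)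
      have fab: "(f a, f (Suc a + t)) \<in> gadj G" using ij(5) cS [of a] cS [of b] Suc b t by simp
      have "linked v (g 0) (g (n - t))"
      proof (rule less.IH)
        show "n - t < n" using t by simp
        show "(v, g 0) \<in> gadj G" "(v, g (n - t)) \<in> gadj G" using ends g0 gn by auto
        show "(g x, g (Suc x)) \<in> gadj G" if "x < n - t" for x
          using that adj [of x] adj [of "x + t"] fab t by (cases "x = a") (auto simp: g_def)
        show "inj_on g {..n - t}"
        proof (rule inj_onI)
          fix x y assume xy: "x \<in> {..n - t}" "y \<in> {..n - t}" "g x = g y"
          define r where "r = (\<lambda>x. if x \<le> a then x else x + t)"
          have "f (r x) = f (r y)" using xy(3) by (simp add: g_def r_def split: if_splits)
          then have "r x = r y" using xy t by (intro inj_onD [OF less.prems(4)]) (auto simp: r_def)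
          then show "x = y" by (auto simp: r_def split: if_splits)
        qed
        show "v \<notin> g ` {..n - t}" using less.prems(5) t by (auto simp: g_def)
      qed
      then show ?thesis using g0 gn by simp
    qed
  qed
qed

text \<open>Deleting \<open>v\<close> leaves the graph connected, so two neighbours of
  \<open>v\<close> are joined by a simple path avoiding \<open>v\<close>.\<close>

lemma chordal_linked:
  assumes "two_connected G" "chordal G" "(v, u) \<in> gadj G" "(v, w) \<in> gadj G"
  shows "linked v u w"
proof -
  let ?H = "induced G (gverts G - {v})"
  have mem: "v \<in> gverts G" "u \<in> gverts G - {v}" "w \<in> gverts G - {v}"
    using gadj_verts [OF fl] assms(3,4) by blast+
  then have "connected_ugraph ?H" using assms(1) by (simp add: two_connected_def)
  then have "(u, w) \<in> (gadj ?H)\<^sup>*" using mem by (auto simp: connected_ugraph_def induced_def)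
  then obtain n f where f: "f 0 = u" "f n = w" "\<And>i. i < n \<Longrightarrow> (f i, f (Suc i)) \<in> gadj ?H"
    "inj_on f {..n::nat}" using rtrancl_simple_path by metis
  have H: "(x, y) \<in> gadj G \<and> x \<noteq> v \<and> y \<noteq> v" if "(x, y) \<in> gadj ?H" for x y
    using that by (auto simp: gadj_def induced_def)
  have "f i \<noteq> v" if "i \<le> n" for i
    using H [OF f(3)] f(2) mem that by (cases "i = n") auto
  then show ?thesis
    using chordal_linked_path [OF assms(2), of v f n] f H assms(3,4) by auto
qed

section \<open>Recognising odd wheels, and returning to the plane\<close>

lemma wedges_ends_inj:
  assumes W: "wheel n h v sp rm" and "e \<in> wedges n sp rm" "f \<in> wedges n sp rm" "ends e = ends f"
  shows "e = f"
  using assms(2,3) unfolding wedges_def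
proof (elim UnE imageE)
  fix i j assume "e = sp i" "f = sp j" "i \<in> {..<n}" "j \<in> {..<n}"
  then show ?thesis using wheel_ends_inj(1) [OF W, of i j] assms(4) by simp
next
  fix i j assume "e = sp i" "f = rm j" "i \<in> {..<n}" "j \<in> {..<n}"
  then show ?thesis using wheel_ends_inj(3) [OF W, of i j] assms(4) by simp
next
  fix i j assume "e = rm i" "f = sp j" "i \<in> {..<n}" "j \<in> {..<n}"
  then show ?thesis using wheel_ends_inj(3) [OF W, of j i] assms(4) by simp
next
  fix i j assume "e = rm i" "f = rm j" "i \<in> {..<n}" "j \<in> {..<n}"
  then show ?thesis using wheel_ends_inj(2) [OF W, of i j] assms(4) by simp
qed

lemma is_odd_wheel_if_wheel:
  assumes con: "connected_ugraph G" and W: "wheel n h v sp rm" and E: "gedges G = wedges n sp rm"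
    and "odd n"
  shows "is_odd_wheel G"
proof -
  have n: "n \<ge> 3" and v: "inj_on v {..<n}" "\<And>i. i < n \<Longrightarrow> v i \<noteq> h"
    and ends: "\<And>i. i < n \<Longrightarrow> ends (sp i) = {h, v i}" "\<And>i. i < n \<Longrightarrow> ends (rm i) = {v i, v (Suc i mod n)}"
    using W by (auto simp: wheel_def)
  have nx: "Suc i mod n < n" for i using n by simp
  have mem: "sp i \<in> gedges G" "rm i \<in> gedges G" if "i < n" for i
    using that E by (auto simp: wedges_def)
  have spoke: "(h, v i) \<in> gadj G" if "i < n" for i using mem ends that gadj_ends by blast
  have h: "h \<in> gverts G" using gadj_verts [OF fl spoke [of 0]] n by simp
  have ev: "ends e \<subseteq> insert h (v ` {..<n})" if "e \<in> gedges G" for e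
    using that ends nx unfolding E wedges_def by auto
  \<comment> \<open>By connectivity every vertex other than the hub lies on an edge, hence on the
    wheel.\<close>
  have verts: "gverts G = insert h (v ` {..<n})"
  proof
    show "insert h (v ` {..<n}) \<subseteq> gverts G" using h gadj_verts [OF fl spoke] by auto
    show "gverts G \<subseteq> insert h (v ` {..<n})"
    proof
      fix x assume "x \<in> gverts G"
      then have "(x, h) \<in> (gadj G)\<^sup>*" using con h by (simp add: connected_ugraph_def)
      then show "x \<in> insert h (v ` {..<n})"
      proof (cases rule: converse_rtranclE)
        case (step y)
        then obtain e where "e \<in> gedges G" "ends e = {x, y}" by (auto simp: gadj_ends)
        then show ?thesis using ev by blast
      qed simp
    qed
  qed
  have rim: "gverts G - {h} = v ` {..<n}" using verts v(2) by auto
  have simple: "simple_ugraph G"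
    unfolding simple_ugraph_def using fl wedges_ends_inj [OF W] ends_gends E by (auto simp: inj_on_def)
  let ?C = "induced G (gverts G - {h})"
  have "simple_ugraph ?C"
    using simple unfolding simple_ugraph_def fin_loopless_def induced_def by (auto intro: inj_on_subset)
  moreover have "ucycle ?C (map v [0..<n])"
  proof -
    have "(v i, v (Suc i mod n)) \<in> gadj ?C" if "i < n" for i
    proof -
      have "gends G (rm i) = {v i, v (Suc i mod n)}" using ends(2) ends_gends mem that by simp
      moreover have "{v i, v (Suc i mod n)} \<subseteq> gverts G - {h}" using rim that nx by auto
      ultimately have "rm i \<in> gedges ?C" "gends ?C (rm i) = {v i, v (Suc i mod n)}"
        using mem that by (auto simp: induced_def)
      then show ?thesis by (auto simp: gadj_def)
    qed
    then show ?thesis using n v(1) nx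
      by (auto simp: ucycle_def distinct_map atLeast0LessThan)
  qed
  moreover have "\<exists>i<n. gends ?C e = {map v [0..<n] ! i, map v [0..<n] ! (Suc i mod n)}"
    if "e \<in> gedges ?C" for e
  proof -
    have e: "e \<in> gedges G" "gends G e \<subseteq> gverts G - {h}" using that by (auto simp: induced_def)
    then have "h \<notin> ends e" using ends_gends by auto
    then have "e \<notin> sp ` {..<n}" using ends(1) by auto
    then obtain i where i: "i < n" "e = rm i" using e E by (auto simp: wedges_def)
    then have "gends ?C e = {v i, v (Suc i mod n)}"
      using ends(2) [OF i(1)] ends_gends [OF e(1)] by (simp add: induced_def)
    then show ?thesis using i nx by auto
  qed
  ultimately have "is_cycle_graph n ?C"
    unfolding is_cycle_graph_def using rim
    by (intro conjI exI [of _ "map v [0..<n]"]) (auto simp: induced_def atLeast0LessThan)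
  moreover have "(h, x) \<in> gadj G" if "x \<in> gverts G - {h}" for x
    using spoke that unfolding rim by auto
  ultimately have "is_wheel n G"
    unfolding is_wheel_def using n simple h by blast
  then show ?thesis using \<open>odd n\<close> by (auto simp: is_odd_wheel_def)
qed

lemma S1_flow_if_unitflow:
  assumes "unitflow s d (gedges G)"
  shows "\<exists>D f. S1_flow G D f"
proof -
  obtain f :: "'e \<Rightarrow> complex" where f: "\<forall>e\<in>gedges G. cmod (f e) = 1" "\<forall>v. bd s d (gedges G) f v = 0"
    using assms by (auto simp: unitflow_def)
  define D :: "('v, 'e) pre_digraph" where "D = \<lparr>verts = gverts G, arcs = gedges G, tail = s, head = d\<rparr>"
  define vec :: "complex \<Rightarrow> real ^ 2" where "vec = (\<lambda>z. \<chi> i. if i = 1 then Re z else Im z)"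
  have vec_sum: "(\<Sum>e\<in>A. vec (f e)) = vec (\<Sum>e\<in>A. f e)" for A
    by (simp add: vec_def vec_eq_iff)
  have norm: "norm (vec z) = cmod z" for z
    by (simp add: vec_def norm_vec_def L2_set_def sum_2 cmod_def)
  have "(\<Sum>e\<in>out_arcs D v. f e) = (\<Sum>e\<in>in_arcs D v. f e)" for v
  proof -
    have fin: "finite (gedges G)" using fl by (simp add: fin_loopless_def)
    have out: "(\<Sum>e\<in>out_arcs D v. f e) = (\<Sum>e\<in>gedges G. if s e = v then f e else 0)"
      using sum.inter_filter [OF fin, of f "\<lambda>e. s e = v"] by (simp add: out_arcs_def D_def)
    have inn: "(\<Sum>e\<in>in_arcs D v. f e) = (\<Sum>e\<in>gedges G. if d e = v then f e else 0)"
      using sum.inter_filter [OF fin, of f "\<lambda>e. d e = v"] by (simp add: in_arcs_def D_def)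
    have "bd s d (gedges G) f v
        = (\<Sum>e\<in>gedges G. (if s e = v then f e else 0) - (if d e = v then f e else 0))"
      unfolding bd_def by (intro sum.cong) auto
    then show ?thesis using f(2) unfolding out inn by (simp add: sum_subtractf)
  qed
  then have "S1_flow G D (\<lambda>e. vec (f e))"
    using f(1) ends_gends unfolding S1_flow_def orientation_def vec_sum
    by (simp add: norm) (auto simp: D_def ends_def)
  then show ?thesis by blast
qed

end

text \<open>Elements of the edge type outside \<open>G\<close> also need distinct ends; an actual
  edge supplies two vertices for them.\<close>

lemma ex_oriented_graph:
  fixes G :: "('v, 'e) ugraph"
  assumes "fin_loopless G" "gedges G \<noteq> {}"
  obtains s d where "oriented_graph s d G"
proof -
  have two: "\<exists>u v. u \<noteq> v \<and> gends G e = {u, v}" if "e \<in> gedges G" for e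
    using assms(1) that card_2_iff [of "gends G e"] by (auto simp: fin_loopless_def)
  obtain e0 where "e0 \<in> gedges G" using assms(2) by blast
  then obtain a b :: 'v where "a \<noteq> b" using two by blast
  have "\<exists>u v. u \<noteq> v \<and> (e \<in> gedges G \<longrightarrow> gends G e = {u, v})" for e
    using two \<open>a \<noteq> b\<close> by blast
  then obtain s d where sd: "\<And>e. s e \<noteq> d e" "\<And>e. e \<in> gedges G \<Longrightarrow> gends G e = {s e, d e}"
    by metis
  then interpret loopless s d by unfold_locales
  have "oriented_graph s d G"
    using assms(1) sd(2) by unfold_locales (auto simp: ends_def)
  then show thesis using that by blast
qed

theorem corollary1p8:
  fixes G :: "('v, 'e) ugraph"
  assumes "fin_loopless G"
    and "connected_ugraph G"
    and "bridgeless G"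
    and "\<not> is_odd_wheel G"
    and "(\<exists>H :: ('v, 'h) ugraph. fin_loopless H \<and> connected_ugraph H \<and> card (gverts H) \<ge> 3 \<and>
            is_square_of G H)
         \<or> locally_connected_ugraph G
         \<or> (two_connected G \<and> chordal G)"
  shows "\<exists>D f. S1_flow G D f"
proof (cases "gedges G = {}")
  \<comment> \<open>Edgeless graphs are treated apart: over a vertex type with one element no
    instance of \<open>loopless\<close> exists.\<close>
  case True
  have "S1_flow G \<lparr>verts = gverts G, arcs = {}, tail = undefined, head = undefined\<rparr> (\<lambda>e. 0)"
    using True by (simp add: S1_flow_def orientation_def)
  then show ?thesis by blast
next
  case False
  then obtain s d where "oriented_graph s d G" using ex_oriented_graph assms(1) by blast
  then interpret oriented_graph s d G .
  have "linked v u w" if "(v, u) \<in> gadj G" "(v, w) \<in> gadj G" for v u w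
    using assms(5) square_linked locally_connected_linked chordal_linked that by blast
  then have "tricon (gedges G)" by (rule tricon_graph [OF assms(2)])
  moreover have "finite (gedges G)" using assms(1) by (simp add: fin_loopless_def)
  moreover have "\<nexists>e. gedges G = {e}" by (rule bridgeless_not_single [OF assms(1,3)])
  moreover have "\<nexists>n h v sp rm. odd n \<and> wheel n h v sp rm \<and> gedges G = wedges n sp rm"
    using is_odd_wheel_if_wheel [OF assms(2)] assms(4) by blast
  ultimately show ?thesis by (intro S1_flow_if_unitflow tricon_unitflow)
qed

end
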